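(* Let $m,n,p$ be positive integers, let $L\in\mathbb{C}^{p\times p}$ be a doubly real-preserving unitary transformation, and let $\mathcal{A}\in\mathbb{K}_p^{m\times n}(L)$ have a T-SVD factorization $\mathcal{A}=\mathcal{U}*_L\mathcal{S}*_L\mathcal{V}^\top$, where $\mathcal{S}=\mathrm{diag}(\mathbf s_{11},\dots,\mathbf s_{\min\{m,n\},\min\{m,n\}})=G(\mathcal{A})$ is an s-diagonal tubal matrix, and let $\mathbf d_{ii}=\phi_L(\mathbf s_{ii})$. For $1\le j<p\min\{m,n\}$, let $\mathbf d_{ii}^{(j)}\in\mathbb{K}_p$ be defined by $\mathbf d_{ii}^{(j)}(k)=\mathbf d_{ii}(k)$ if $\eta(i,k)\le j$, and $\mathbf d_{ii}^{(j)}(k)=0$ otherwise. Let $\mathbf s_{ii}^{(j)}=\phi_L^{-1}(\mathbf d_{ii}^{(j)})$ for $i=1,\dots,\min\{m,n\}$, $\mathcal{S}_j=\mathrm{diag}(\mathbf s_{11}^{(j)},\dots,\mathbf s_{\min\{m,n\},\min\{m,n\}}^{(j)})$ and $\mathcal{A}_j=\mathcal{U}*_L\mathcal{S}_j*_L\mathcal{V}^\top$. Then $\mathcal{A}_j$ is the best B-rank $j$ approximation of $\mathcal{A}$ (i.e. it minimizes $\|\mathcal{A}-\mathcal{B}\|_F$ over all $\mathcal{B}\in\mathbb{K}_p^{m\times n}$ of B-rank at most $j$), with $$\|\mathcal{A}-\mathcal{A}_j\|_F^2=\nu_j^2.$$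
   Context: For an invertible $L\in\mathbb{C}^{p\times p}$ put $\phi_L(\mathbf a)=L\mathbf a$, $\phi_L^{-1}(\mathbf a)=L^{-1}\mathbf a$ for $\mathbf a\in\mathbb{C}^p$, and $\mathbf a\odot_L\mathbf b=\phi_L^{-1}(\phi_L(\mathbf a)\circ\phi_L(\mathbf b))$, where $\circ$ is the Hadamard (entrywise) product. $\mathbf a(k)$ denotes the $k$th component. $L$ is real-preserving if $\mathbf a\odot_L\mathbf b\in\mathbb{R}^p$ for all $\mathbf a,\mathbf b\in\mathbb{R}^p$; then $\mathbb{K}_p=\mathbb{K}_p(L)=(\mathbb{R}^p,+,\odot_L)$ is a commutative ring with unit $\mathbf e_L$, whose elements are called tubal scalars. Let $\psi_L(\mathbf a)=\phi_L^{-1}(\overline{\phi_L(\mathbf a)})$. $L$ is doubly real-preserving if it is real-preserving and $\psi_L(\mathbf a)\in\mathbb{R}^p$ for all $\mathbf a\in\mathbb{R}^p$; then $\mathbf a^\top:=\psi_L(\mathbf a)$. A doubly real-preserving unitary transformation is a doubly real-preserving $L$ that is a unitary matrix. A tubal scalar is symmetric if $\mathbf a^\top=\mathbf a$; a symmetric $\mathbf a$ is positive semi-definite if $\phi_L(\mathbf a)(k)\ge 0$ for all $k$. $\mathbb{K}_p^{m\times n}=\mathbb{K}_p^{m\times n}(L)$ is the set of tubal matrices, i.e. $m\times n$ matrices $\mathcal{A}=(\mathbf a_{ij})$ with entries in $\mathbb{K}_p$. The product $\mathcal{A}*_L\mathcal{B}$ has $(i,j)$ entry $\sum_l\mathbf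 a_{il}\odot_L\mathbf b_{lj}$. The transpose $\mathcal{A}^\top$ has $(i,j)$ entry $\mathbf a_{ji}^\top$. The identity tubal matrix has diagonal entries $\mathbf e_L$ and off-diagonal entries $\mathbf 0$; a square $\mathcal{A}$ is orthogonal if $\mathcal{A}^{-1}=\mathcal{A}^\top$. A tubal matrix is diagonal if all off-diagonal entries are $\mathbf 0$. The Frobenius norm is $\|\mathcal{A}\|_F=\sqrt{\sum_{i,j}|\mathbf a_{ij}|^2}$ with $|\mathbf a|=\sqrt{\sum_k\mathbf a(k)^2}$. For $\mathcal{A}\in\mathbb{K}_p^{m\times n}$ let $\Phi_L(\mathcal{A})(k)=(\phi_L(\mathbf a_{ij})(k))\in\mathbb{C}^{m\times n}$, and let $\mathbf d_{11}(k)\ge\cdots\ge\mathbf d_{\min\{m,n\},\min\{m,n\}}(k)\ge0$ be its singular values (with multiplicity, including zeros). Put $\mathbf s_{ll}=\phi_L^{-1}(\mathbf d_{ll})$; $G(\mathcal{A})$ is the diagonal tubal matrix $\mathrm{diag}(\mathbf s_{11},\dots,\mathbf s_{\min\{m,n\},\min\{m,n\}})$. A T-SVD factorization of $\mathcal{A}$ is $\mathcal{A}=\mathcal{U}*_L\mathcal{S}*_L\mathcal{V}^\top$ with $\mathcal{U}\in\mathbb{K}_p^{m\times m}$, $\mathcal{V}\in\mathbb{K}_p^{n\times n}$ orthogonal and $\mathcal{S}=G(\mathcal{A})$. A diagonal tubal matrix is s-diagonal if its diagonal entries $\mathbf a_{ii}$ are symmetric and positive semi-definite, and $\phi_L(\mathbf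 a_{11})(k)\ge\cdots\ge\phi_L(\mathbf a_{\min\{m,n\},\min\{m,n\}})(k)$ for every $k$. The $j$th largest B-singular value $\mu_j$ of $\mathcal{A}$ ($1\le j\le p\min\{m,n\}$) is the $j$th largest number (with multiplicity) among all $\mathbf d_{ii}(k)$, $1\le i\le\min\{m,n\}$, $1\le k\le p$. The B-rank of $\mathcal{A}$ is the number of its nonzero B-singular values. The $j$th B-tail energy is $\nu_j=\sqrt{\sum_{l=j+1}^{p\min\{m,n\}}\mu_l^2}$. Fix a bijection $\eta:\{1,\dots,\min\{m,n\}\}\times\{1,\dots,p\}\to\{1,\dots,p\min\{m,n\}\}$ such that $\mathbf d_{ii}(k)=\mu_{\eta(i,k)}$ for all $i,k$.
   Formalization: That A_j lies in K_p^{m×n} is claimed only when all s_ii^{(j)} are real, since truncation can split conjugate pairs; otherwise A_j is a complex array, and its B-rank bound, the comparison with every B and the error formula still hold, with ‖·‖_F taken with moduli. *)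

theory Defs
  imports
    "Jordan_Normal_Form.Schur_Decomposition"
    "Jordan_Normal_Form.Gauss_Jordan_Elimination"
    "HOL-Computational_Algebra.Fundamental_Theorem_Algebra"
begin

text \<open>
  All indices are 0-based. Tubal scalars are complex vectors with real entries, and tubal matrices
  are matrices of such vectors. The operations below are defined on all complex vectors, the set
  \<open>tubal_scalars p\<close> singles out the copy of $\mathbb{R}^p$. The dimension \<open>p\<close> is read off from the
  transformation \<open>L\<close>.
\<close>

definition tubal_scalars :: "nat \<Rightarrow> complex vec set" where
  "tubal_scalars p = {a \<in> carrier_vec p. \<forall>k<p. a $ k \<in> \<real>}"

definition tubal_matrices :: "nat \<Rightarrow> nat \<Rightarrow> nat \<Rightarrow> complex vec mat set" where
  "tubal_matrices p m n =
     {A \<in> carrier_mat m n. \<forall>i<m. \<forall>j<n. A $$ (i, j) \<in> tubal_scalars p}"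

definition phi :: "complex mat \<Rightarrow> complex vec \<Rightarrow> complex vec" where
  "phi L a = L *\<^sub>v a"

definition phi_inv :: "complex mat \<Rightarrow> complex vec \<Rightarrow> complex vec" where
  "phi_inv L a = the (mat_inverse L) *\<^sub>v a"

definition hadamard :: "complex vec \<Rightarrow> complex vec \<Rightarrow> complex vec" where
  "hadamard a b = vec (dim_vec a) (\<lambda>k. a $ k * b $ k)"

definition tmult :: "complex mat \<Rightarrow> complex vec \<Rightarrow> complex vec \<Rightarrow> complex vec" where
  "tmult L a b = phi_inv L (hadamard (phi L a) (phi L b))"

text \<open>The unit of $\odot_L$ is the vector that \<open>phi L\<close> maps to the all-ones vector.\<close>

definition tunit :: "complex mat \<Rightarrow> complex vec" where
  "tunit L = phi_inv L (vec (dim_row L) (\<lambda>_. 1))"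

definition psi :: "complex mat \<Rightarrow> complex vec \<Rightarrow> complex vec" where
  "psi L a = phi_inv L (conjugate (phi L a))"

definition real_preserving :: "nat \<Rightarrow> complex mat \<Rightarrow> bool" where
  "real_preserving p L \<longleftrightarrow> L \<in> carrier_mat p p \<and> invertible_mat L \<and>
     (\<forall>a \<in> tubal_scalars p. \<forall>b \<in> tubal_scalars p. tmult L a b \<in> tubal_scalars p)"

definition doubly_real_preserving :: "nat \<Rightarrow> complex mat \<Rightarrow> bool" where
  "doubly_real_preserving p L \<longleftrightarrow> real_preserving p L \<and>
     (\<forall>a \<in> tubal_scalars p. psi L a \<in> tubal_scalars p)"

definition unitary_mat :: "complex mat \<Rightarrow> bool" where
  "unitary_mat L \<longleftrightarrow> square_mat L \<and> inverts_mat L (mat_adjoint L) \<and> inverts_mat (mat_adjoint L) L"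

definition tscalar_symmetric :: "complex mat \<Rightarrow> complex vec \<Rightarrow> bool" where
  "tscalar_symmetric L a \<longleftrightarrow> psi L a = a"

definition tscalar_psd :: "complex mat \<Rightarrow> complex vec \<Rightarrow> bool" where
  "tscalar_psd L a \<longleftrightarrow> tscalar_symmetric L a \<and>
     (\<forall>k < dim_row L. phi L a $ k \<in> \<real> \<and> Re (phi L a $ k) \<ge> 0)"

definition tprod :: "complex mat \<Rightarrow> complex vec mat \<Rightarrow> complex vec mat \<Rightarrow> complex vec mat" where
  "tprod L A B = mat (dim_row A) (dim_col B) (\<lambda>(i, j).
     vec (dim_row L) (\<lambda>k. \<Sum>l < dim_col A. tmult L (A $$ (i, l)) (B $$ (l, j)) $ k))"

definition ttranspose :: "complex mat \<Rightarrow> complex vec mat \<Rightarrow> complex vec mat" where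
  "ttranspose L A = mat (dim_col A) (dim_row A) (\<lambda>(i, j). psi L (A $$ (j, i)))"

definition tdiag :: "nat \<Rightarrow> nat \<Rightarrow> nat \<Rightarrow> (nat \<Rightarrow> complex vec) \<Rightarrow> complex vec mat" where
  "tdiag p m n s = mat m n (\<lambda>(i, j). if i = j then s i else 0\<^sub>v p)"

definition tidentity :: "complex mat \<Rightarrow> nat \<Rightarrow> complex vec mat" where
  "tidentity L n = tdiag (dim_row L) n n (\<lambda>_. tunit L)"

definition torthogonal :: "complex mat \<Rightarrow> nat \<Rightarrow> complex vec mat \<Rightarrow> bool" where
  "torthogonal L n U \<longleftrightarrow> U \<in> tubal_matrices (dim_row L) n n \<and>
     tprod L U (ttranspose L U) = tidentity L n \<and> tprod L (ttranspose L U) U = tidentity L n"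

text \<open>
  On tubal matrices this is the Frobenius norm of real data; the modulus extends it to arrays with
  complex entries.
\<close>

definition frob_norm :: "complex vec mat \<Rightarrow> real" where
  "frob_norm A = sqrt (\<Sum>i < dim_row A. \<Sum>j < dim_col A.
     \<Sum>k < dim_vec (A $$ (i, j)). (cmod (A $$ (i, j) $ k))\<^sup>2)"

definition slice :: "complex mat \<Rightarrow> complex vec mat \<Rightarrow> nat \<Rightarrow> complex mat" where
  "slice L A k = mat (dim_row A) (dim_col A) (\<lambda>(i, j). phi L (A $$ (i, j)) $ k)"

text \<open>
  The singular values of an $m \times n$ matrix $M$ are the square roots of the eigenvalues of
  $M^* M$, counted with algebraic multiplicity, in decreasing order. There are $n$ eigenvalues;
  if $m < n$, the last $n - m$ of them vanish and are dropped.
\<close>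

definition singular_values :: "complex mat \<Rightarrow> real list" where
  "singular_values M = take (min (dim_row M) (dim_col M)) (rev (sorted_list_of_multiset
     (image_mset (\<lambda>z. sqrt (Re z)) (proots (char_poly (mat_adjoint M * M))))))"

definition G_mat :: "complex mat \<Rightarrow> complex vec mat \<Rightarrow> complex vec mat" where
  "G_mat L A = tdiag (dim_row L) (dim_row A) (dim_col A)
     (\<lambda>l. phi_inv L (vec (dim_row L) (\<lambda>k. of_real (singular_values (slice L A k) ! l))))"

definition is_tsvd ::
  "complex mat \<Rightarrow> complex vec mat \<Rightarrow> complex vec mat \<Rightarrow> complex vec mat \<Rightarrow> complex vec mat \<Rightarrow> bool"
where
  "is_tsvd L A U S V \<longleftrightarrow> torthogonal L (dim_row A) U \<and> torthogonal L (dim_col A) V \<and>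
     S = G_mat L A \<and> A = tprod L (tprod L U S) (ttranspose L V)"

definition s_diagonal :: "complex mat \<Rightarrow> nat \<Rightarrow> nat \<Rightarrow> complex vec mat \<Rightarrow> bool" where
  "s_diagonal L m n S \<longleftrightarrow> S \<in> tubal_matrices (dim_row L) m n \<and>
     (\<forall>i<m. \<forall>j<n. i \<noteq> j \<longrightarrow> S $$ (i, j) = 0\<^sub>v (dim_row L)) \<and>
     (\<forall>i < min m n. tscalar_symmetric L (S $$ (i, i)) \<and> tscalar_psd L (S $$ (i, i))) \<and>
     (\<forall>k < dim_row L. \<forall>i. Suc i < min m n \<longrightarrow>
        Re (phi L (S $$ (Suc i, Suc i)) $ k) \<le> Re (phi L (S $$ (i, i)) $ k))"

definition B_singular_values :: "complex mat \<Rightarrow> complex vec mat \<Rightarrow> real list" where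
  "B_singular_values L A =
     rev (sort (concat (map (\<lambda>k. singular_values (slice L A k)) [0..<dim_row L])))"

definition B_rank :: "complex mat \<Rightarrow> complex vec mat \<Rightarrow> nat" where
  "B_rank L A = length (filter (\<lambda>x. x \<noteq> 0) (B_singular_values L A))"

text \<open>
  Dropping the first \<open>j\<close> entries leaves the 1-based positions \<open>j + 1, \<dots>, p min{m,n}\<close>.
\<close>

definition B_tail_energy :: "complex mat \<Rightarrow> complex vec mat \<Rightarrow> nat \<Rightarrow> real" where
  "B_tail_energy L A j = sqrt (\<Sum>x \<leftarrow> drop j (B_singular_values L A). x\<^sup>2)"

end

theory Submission
  imports Defs
begin

text \<open>
  A unitary \<open>L\<close>, applied to every entry, turns a tubal matrix into its \<open>p\<close> slices. This preserves the
  Frobenius norm and turns the tubal product, transpose and orthogonality into the matrix product, the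
  adjoint and unitarity of each slice (locale \<open>unitary_transform\<close>). The statement thus becomes an
  Eckart--Young theorem for a block diagonal matrix with \<open>p\<close> blocks: the B-rank is the total number of
  nonzero singular values of the blocks, and a bound on it does not fix how the rank is distributed
  over the blocks.

  In every slice, \<open>A\<close> and its truncation are diagonal matrices between the same two unitary factors.
  Their difference is therefore measured by the dropped B-singular values, which gives the error
  formula, and the truncation has at most \<open>j\<close> nonzero B-singular values
  (\<open>sv_rank_unitary_rect_diag\<close>).

  For optimality let \<open>N\<close> be a slice of a competitor and \<open>M = U D V\<^sup>*\<close> the slice of \<open>A\<close>. The error \<open>M - N\<close> is
  at least its restriction to the kernel of \<open>N\<close>, where it equals \<open>M\<close>. This restriction has squared norm
  \<open>\<Sum>\<^sub>i \<sigma>\<^sub>i\<^sup>2 t\<^sub>i\<close>, where \<open>t\<^sub>i\<close> is the squared length of the projection of the \<open>i\<close>-th column of \<open>V\<close> onto the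
  kernel. So \<open>0 \<le> t\<^sub>i \<le> 1\<close>, and the \<open>t\<^sub>i\<close> have total mass at least \<open>min m n\<close> minus the number of nonzero
  singular values of \<open>N\<close> (\<open>unitary_rect_diag_approximation_weights\<close>). Over all slices together the mass is
  at least \<open>p min m n - j\<close>, and a weighted sum of the \<open>\<mu>\<^sub>l\<^sup>2\<close> under these constraints is least when the
  weights are 1 on the smallest \<open>p min m n - j\<close> values and 0 elsewhere (\<open>rearrangement_threshold\<close>). That
  least value is the squared tail energy.

  The kernel of \<open>N\<close> has to be compared with singular values counted by algebraic multiplicity, as roots
  of the characteristic polynomial of \<open>N\<^sup>* N\<close>. The spectral theorem for Hermitian matrices
  (\<open>hermitian_unitary_diagonalization\<close>) provides an orthonormal basis in which the two notions can be
  read off the same diagonal.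
\<close>

section \<open>Adjoints, unitary matrices and column norms\<close>

lemma mat_adjoint_carrier [simp]:
  "A \<in> carrier_mat m n \<Longrightarrow> mat_adjoint A \<in> carrier_mat n m"
  by (auto simp: mat_adjoint_def)

lemma dim_mat_adjoint [simp]:
  "dim_row (mat_adjoint A) = dim_col A" "dim_col (mat_adjoint A) = dim_row A"
  by (auto simp: mat_adjoint_def)

lemma index_mat_adjoint [simp]:
  fixes A :: "complex mat"
  assumes "i < dim_col A" "j < dim_row A"
  shows "mat_adjoint A $$ (i, j) = cnj (A $$ (j, i))"
  using assms by (simp add: mat_adjoint_def mat_of_rows_def)

lemma mat_adjoint_adjoint [simp]:
  fixes A :: "complex mat"
  shows "mat_adjoint (mat_adjoint A) = A"
  by (rule eq_matI) auto

lemma mat_adjoint_mult: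
  fixes A B :: "complex mat"
  assumes "A \<in> carrier_mat m l" "B \<in> carrier_mat l n"
  shows "mat_adjoint (A * B) = mat_adjoint B * mat_adjoint A"
  by (rule eq_matI) (use assms in \<open>auto simp: scalar_prod_def mult.commute\<close>)

lemma index_mult_sum:
  fixes A B :: "complex mat"
  assumes "A \<in> carrier_mat m l" "B \<in> carrier_mat l n" "i < m" "j < n"
  shows "(A * B) $$ (i, j) = (\<Sum>k<l. A $$ (i, k) * B $$ (k, j))"
  using assms by (auto simp: scalar_prod_def atLeast0LessThan)

lemma unitary_matD:
  assumes "unitary_mat W" "W \<in> carrier_mat n n"
  shows "W * mat_adjoint W = 1\<^sub>m n" "mat_adjoint W * W = 1\<^sub>m n"
  using assms by (auto simp: unitary_mat_def inverts_mat_def)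

lemma unitary_matI:
  assumes "W \<in> carrier_mat n n" "mat_adjoint W * W = 1\<^sub>m n"
  shows "unitary_mat W"
  using assms mat_mult_left_right_inverse[OF mat_adjoint_carrier[OF assms(1)] assms(1)]
  by (auto simp: unitary_mat_def inverts_mat_def)

lemma unitary_mat_adjoint:
  assumes "unitary_mat W" "W \<in> carrier_mat n n"
  shows "unitary_mat (mat_adjoint W)"
  using assms unitary_matD[OF assms] by (intro unitary_matI[of _ n]) auto

text \<open>
  The Gram matrix \<open>X\<^sup>* X\<close> is blind to a unitary factor on the left. Norms of columns, and with
  them the Frobenius norm, are read off its diagonal, so their invariance follows from here.
\<close>

lemma gram_unitary_mult:
  assumes U: "unitary_mat U" "U \<in> carrier_mat m m" and X: "X \<in> carrier_mat m n"
  shows "mat_adjoint (U * X) * (U * X) = mat_adjoint X * X"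
proof -
  have "mat_adjoint (U * X) * (U * X) = mat_adjoint X * (mat_adjoint U * (U * X))"
    using U(2) X by (simp add: mat_adjoint_mult[OF U(2) X] assoc_mult_mat[of _ n m _ m _ n])
  also have "mat_adjoint U * (U * X) = mat_adjoint U * U * X"
    using U(2) X by (intro assoc_mult_mat[symmetric, of _ m m _ m _ n]) auto
  also have "\<dots> = X"
    using X by (simp add: unitary_matD[OF U])
  finally show ?thesis .
qed

lemma unitary_mat_mult:
  assumes "unitary_mat U" "U \<in> carrier_mat n n" "unitary_mat W" "W \<in> carrier_mat n n"
  shows "unitary_mat (U * W)"
  using assms by (intro unitary_matI[of _ n]) (auto simp: gram_unitary_mult unitary_matD)

text \<open>
  Column norms are kept separate from the Frobenius norm because the optimality argument sums the
  columns that lie in the kernel of the competitor only.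
\<close>

definition col_norm2 :: "complex mat \<Rightarrow> nat \<Rightarrow> real" where
  "col_norm2 X c = (\<Sum>i<dim_row X. (cmod (X $$ (i, c)))\<^sup>2)"

definition frob2 :: "complex mat \<Rightarrow> real" where
  "frob2 X = (\<Sum>c<dim_col X. col_norm2 X c)"

lemma col_norm2_nonneg: "0 \<le> col_norm2 X c"
  by (simp add: col_norm2_def sum_nonneg)

lemma frob2_nonneg: "0 \<le> frob2 X"
  by (simp add: frob2_def sum_nonneg col_norm2_nonneg)

lemma col_norm2_gram:
  assumes "X \<in> carrier_mat m n" "c < n"
  shows "(mat_adjoint X * X) $$ (c, c) = of_real (col_norm2 X c)"
proof -
  have "(mat_adjoint X * X) $$ (c, c) = (\<Sum>i<m. cnj (X $$ (i, c)) * X $$ (i, c))"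
    using assms by (subst index_mult_sum[of _ n m _ n]) auto
  also have "\<dots> = of_real (col_norm2 X c)"
    using assms by (simp add: col_norm2_def complex_norm_square mult.commute flip: of_real_power)
  finally show ?thesis .
qed

lemma col_norm2_unitary_mult:
  assumes "unitary_mat U" "U \<in> carrier_mat m m" "X \<in> carrier_mat m n" "c < n"
  shows "col_norm2 (U * X) c = col_norm2 X c"
  using col_norm2_gram[of "U * X" m n c] col_norm2_gram[of X m n c] assms
  by (simp add: gram_unitary_mult)

lemma col_norm2_unitary:
  assumes "unitary_mat U" "U \<in> carrier_mat n n" "c < n"
  shows "col_norm2 U c = 1"
  using col_norm2_gram[of U n n c] assms by (simp add: unitary_matD)

lemma frob2_unitary_mult_left:
  assumes "unitary_mat U" "U \<in> carrier_mat m m" "X \<in> carrier_mat m n"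
  shows "frob2 (U * X) = frob2 X"
  using assms by (auto simp: frob2_def intro!: sum.cong col_norm2_unitary_mult)

lemma frob2_adjoint: "frob2 (mat_adjoint X) = frob2 X"
  unfolding frob2_def col_norm2_def by (subst sum.swap) auto

lemma frob2_unitary_mult_right:
  assumes "unitary_mat W" "W \<in> carrier_mat n n" "X \<in> carrier_mat m n"
  shows "frob2 (X * W) = frob2 X"
proof -
  have "frob2 (X * W) = frob2 (mat_adjoint W * mat_adjoint X)"
    using assms by (metis frob2_adjoint mat_adjoint_mult)
  also have "\<dots> = frob2 (mat_adjoint X)"
    using assms by (intro frob2_unitary_mult_left[of _ n _ m]) (auto intro: unitary_mat_adjoint)
  finally show ?thesis by (simp add: frob2_adjoint)
qed

section \<open>Unitary diagonalization of Hermitian matrices\<close>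

text \<open>
  Extend \<open>v\<close> to a basis and orthogonalize; the Gram--Schmidt process leaves the first vector as it is
  and returns vectors of arbitrary length, so that scaling each of them to unit length gives the
  columns of a unitary matrix.
\<close>

lemma vector_in_unitary_basis:
  fixes v :: "complex vec"
  assumes v: "v \<in> carrier_vec n" and v0: "v \<noteq> 0\<^sub>v n"
  obtains W a where "unitary_mat W" "W \<in> carrier_mat n n" "col W 0 = a \<cdot>\<^sub>v v" "a \<noteq> 0"
proof -
  interpret cof_vec_space n "TYPE(complex)" .
  define b where "b = basis_completion v"
  note b = basis_completion[OF v v0, folded b_def]
  define ws where "ws = gram_schmidt n b"
  have n: "n \<noteq> 0" using v v0 by auto
  obtain vs where bv: "b = v # vs" using b n by (cases b) auto
  have ws: "set ws \<subseteq> carrier_vec n" "corthogonal ws" "length ws = n"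
    using gram_schmidt_result[OF b(2,4,5) refl, folded ws_def] b by auto
  have hd: "ws ! 0 = v"
    using gram_schmidt_hd[OF v, of vs, folded bv] ws(3) n
    by (metis hd_conv_nth length_0_conv ws_def)
  define s where "s w = complex_of_real (1 / sqrt (Re (w \<bullet>c w)))" for w :: "complex vec"
  define W where "W = mat_of_cols n (map (\<lambda>w. s w \<cdot>\<^sub>v w) ws)"
  have W: "W \<in> carrier_mat n n"
    using ws unfolding W_def by (metis length_map mat_of_cols_carrier(1))
  have wsc: "ws ! i \<in> carrier_vec n" if "i < n" for i
    using ws that by (metis nth_mem subsetD)
  have colW: "col W i = s (ws ! i) \<cdot>\<^sub>v ws ! i" if "i < n" for i
    using that ws wsc unfolding W_def by (subst col_mat_of_cols) auto
  have real: "w \<bullet>c w = of_real (Re (w \<bullet>c w))" "Re (w \<bullet>c w) \<ge> 0" if "w \<in> carrier_vec n" for w :: "complex vec"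
  proof -
    have "w \<bullet>c w = of_real (\<Sum>i<n. (cmod (w $ i))\<^sup>2)"
      using that by (simp add: scalar_prod_def atLeast0LessThan complex_norm_square
          flip: of_real_power)
    then show "w \<bullet>c w = of_real (Re (w \<bullet>c w))" "Re (w \<bullet>c w) \<ge> 0"
      by (simp_all add: sum_nonneg)
  qed
  have pos: "Re (ws ! i \<bullet>c ws ! i) > 0" if "i < n" for i
  proof -
    have "ws ! i \<bullet>c ws ! i \<noteq> 0" using ws that by (simp add: corthogonalD)
    then show ?thesis
      using real[OF wsc[OF that]] by (metis less_eq_real_def of_real_0)
  qed
  \<comment> \<open>The scaling factors cancel against the squared norms on the diagonal; off the diagonal,
      orthogonality suffices.\<close>
  have "mat_adjoint W * W = 1\<^sub>m n"
  proof (rule eq_matI)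
    fix i j assume "i < dim_row (1\<^sub>m n :: complex mat)" "j < dim_col (1\<^sub>m n :: complex mat)"
    then have ij: "i < n" "j < n" by auto
    note c = wsc[OF ij(1)] wsc[OF ij(2)]
    have "(mat_adjoint W * W) $$ (i, j) = conjugate (col W i) \<bullet> col W j"
      using ij W by (auto simp: scalar_prod_def intro!: sum.cong)
    also have "\<dots> = s (ws ! i) * s (ws ! j) * (ws ! j \<bullet>c ws ! i)"
      using c ij by (simp add: colW s_def conjugate_smult_vec
          comm_scalar_prod[of "conjugate (ws ! i)" n "ws ! j"])
    also have "\<dots> = 1\<^sub>m n $$ (i, j)"
    proof (cases "i = j")
      case True
      have "s (ws ! j) * s (ws ! j) * of_real (Re (ws ! j \<bullet>c ws ! j)) = 1"
        unfolding s_def of_real_mult [symmetric] using pos[OF ij(2)]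
        by (simp add: real_sqrt_mult_self)
      then show ?thesis using True ij real(1)[OF c(2)] by simp
    next
      case False
      then show ?thesis using ij ws by (simp add: corthogonalD)
    qed
    finally show "(mat_adjoint W * W) $$ (i, j) = 1\<^sub>m n $$ (i, j)" .
  qed (use W in auto)
  moreover have "col W 0 = s v \<cdot>\<^sub>v v" using colW[of 0] n hd by simp
  moreover have "s v \<noteq> 0" using pos[of 0] n hd by (simp add: s_def)
  ultimately show ?thesis using that W unitary_matI by blast
qed

definition hermitian :: "complex mat \<Rightarrow> bool" where
  "hermitian H \<longleftrightarrow> mat_adjoint H = H"

lemma hermitian_conjugation:
  assumes "hermitian H" "H \<in> carrier_mat n n" "W \<in> carrier_mat n k"
  shows "hermitian (mat_adjoint W * H * W)"
proof -
  have c: "mat_adjoint W \<in> carrier_mat k n" and cH: "mat_adjoint W * H \<in> carrier_mat k n"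
    using assms by auto
  have "mat_adjoint (mat_adjoint W * H * W) = mat_adjoint W * (mat_adjoint H * W)"
    by (simp add: mat_adjoint_mult[OF cH assms(3)] mat_adjoint_mult[OF c assms(2)])
  also have "\<dots> = mat_adjoint W * H * W"
    using assms(1) by (simp add: hermitian_def assoc_mult_mat[OF c assms(2,3)])
  finally show ?thesis by (simp add: hermitian_def)
qed

lemma hermitian_gram:
  assumes "N \<in> carrier_mat m n"
  shows "hermitian (mat_adjoint N * N)"
  using assms by (simp add: hermitian_def mat_adjoint_mult[of "mat_adjoint N" n m N n])

text \<open>
  The block diagonal matrix \<open>diag(1, P)\<close>, through which a basis change of the orthogonal complement
  of an eigenvector acts on the whole space.
\<close>

definition block_one :: "nat \<Rightarrow> complex mat \<Rightarrow> complex mat" where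
  "block_one n P = four_block_mat (1\<^sub>m 1) (0\<^sub>m 1 n) (0\<^sub>m n 1) P"

lemma block_one_carrier:
  "P \<in> carrier_mat n n \<Longrightarrow> block_one n P \<in> carrier_mat (Suc n) (Suc n)"
  using four_block_carrier_mat[of "1\<^sub>m 1 :: complex mat" 1 1 P n n] by (simp add: block_one_def)

lemma adjoint_block_one:
  assumes "P \<in> carrier_mat n n"
  shows "mat_adjoint (block_one n P) = block_one n (mat_adjoint P)"
  by (rule eq_matI) (use assms in \<open>auto simp: block_one_def\<close>)

lemma unitary_block_one:
  assumes P: "unitary_mat P" "P \<in> carrier_mat n n"
  shows "unitary_mat (block_one n P)"
proof (rule unitary_matI)
  show "block_one n P \<in> carrier_mat (Suc n) (Suc n)"
    by (rule block_one_carrier[OF P(2)])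
  have "block_one n (mat_adjoint P) * block_one n P = block_one n (mat_adjoint P * P)"
    unfolding block_one_def
    by (subst mult_four_block_mat[of _ 1 1 _ n _ n _ _ 1 _ n]) (use P in auto)
  also have "\<dots> = 1\<^sub>m (Suc n)"
    unfolding unitary_matD[OF P] block_one_def by (rule eq_matI) auto
  finally show "mat_adjoint (block_one n P) * block_one n P = 1\<^sub>m (Suc n)"
    by (simp add: adjoint_block_one[OF P(2)])
qed

lemma conjugate_block:
  assumes a: "a \<in> carrier_mat 1 1" and K: "K \<in> carrier_mat n n" and P: "P \<in> carrier_mat n n"
  shows "mat_adjoint (block_one n P) * four_block_mat a (0\<^sub>m 1 n) (0\<^sub>m n 1) K * block_one n P
    = four_block_mat a (0\<^sub>m 1 n) (0\<^sub>m n 1) (mat_adjoint P * K * P)"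
proof -
  have "block_one n (mat_adjoint P) * four_block_mat a (0\<^sub>m 1 n) (0\<^sub>m n 1) K
    = four_block_mat a (0\<^sub>m 1 n) (0\<^sub>m n 1) (mat_adjoint P * K)"
    unfolding block_one_def
    by (subst mult_four_block_mat[of _ 1 1 _ n _ n _ _ 1 _ n]) (use a K P in auto)
  moreover have "four_block_mat a (0\<^sub>m 1 n) (0\<^sub>m n 1) (mat_adjoint P * K) * block_one n P
    = four_block_mat a (0\<^sub>m 1 n) (0\<^sub>m n 1) (mat_adjoint P * K * P)"
  proof -
    have "mat_adjoint P * K \<in> carrier_mat n n" using K P by auto
    then show ?thesis
      unfolding block_one_def
      by (subst mult_four_block_mat[of _ 1 1 _ n _ n _ _ 1 _ n]) (use a K P in auto)
  qed
  ultimately show ?thesis by (simp add: adjoint_block_one[OF P])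
qed

lemma assoc_mult_mat_5:
  fixes A B C D E :: "complex mat"
  assumes A: "A \<in> carrier_mat n n" and B: "B \<in> carrier_mat n n" and C: "C \<in> carrier_mat n n"
    and D: "D \<in> carrier_mat n n" and E: "E \<in> carrier_mat n n"
  shows "A * B * C * (D * E) = A * (B * C * D) * E"
proof -
  have AB: "A * B \<in> carrier_mat n n" and BC: "B * C \<in> carrier_mat n n"
    and ABC: "A * (B * C) \<in> carrier_mat n n"
    using A B C by auto
  show ?thesis
    by (simp only: assoc_mult_mat[OF A B C] assoc_mult_mat[OF A BC D] assoc_mult_mat[OF ABC D E, symmetric])
qed

lemma complex_eigenvector_exists:
  fixes H :: "complex mat"
  assumes H: "H \<in> carrier_mat n n" and n: "n > 0"
  obtains v e where "v \<in> carrier_vec n" "v \<noteq> 0\<^sub>v n" "H *\<^sub>v v = e \<cdot>\<^sub>v v"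
proof -
  have "\<not> constant (poly (char_poly H))"
    using degree_monic_char_poly[OF H] n by (simp add: constant_degree)
  then obtain e where "poly (char_poly H) e = 0"
    using fundamental_theorem_of_algebra by blast
  then have "eigenvalue H e"
    using eigenvalue_root_char_poly[OF H] by simp
  then show ?thesis
    using that H by (auto simp: eigenvalue_def eigenvector_def)
qed

text \<open>
  The spectral theorem by induction on the dimension. In a unitary basis that starts with an
  eigenvector the first column of \<open>H\<close> is a multiple of the first unit vector; since \<open>H\<close> stays Hermitian,
  so is the first row, and the remaining block is a Hermitian matrix of smaller size.
\<close>

theorem hermitian_unitary_diagonalization:
  assumes "hermitian H" "H \<in> carrier_mat n n"
  obtains W where "unitary_mat W" "W \<in> carrier_mat n n" "diagonal_mat (mat_adjoint W * H * W)"
proof -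
  have "\<exists>W. unitary_mat W \<and> W \<in> carrier_mat n n \<and> diagonal_mat (mat_adjoint W * H * W)"
    using assms
  proof (induction n arbitrary: H)
    case 0
    then show ?case
      by (intro exI[of _ "1\<^sub>m 0"]) (auto simp: unitary_mat_def inverts_mat_def diagonal_mat_def)
  next
    case (Suc n)
    note H = Suc.prems
    obtain v e where v: "v \<in> carrier_vec (Suc n)" "v \<noteq> 0\<^sub>v (Suc n)" "H *\<^sub>v v = e \<cdot>\<^sub>v v"
      using complex_eigenvector_exists[OF H(2)] by blast
    obtain W a where W: "unitary_mat W" "W \<in> carrier_mat (Suc n) (Suc n)" and col0: "col W 0 = a \<cdot>\<^sub>v v"
      using vector_in_unitary_basis[OF v(1,2)] by metis
    define K where "K = mat_adjoint W * H * W"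
    have K: "K \<in> carrier_mat (Suc n) (Suc n)" "hermitian K"
      using hermitian_conjugation[OF H W(2)] W(2) H(2) by (auto simp: K_def)
    have colHW: "col (H * W) 0 = e \<cdot>\<^sub>v col W 0"
    proof -
      have "col (H * W) 0 = H *\<^sub>v (a \<cdot>\<^sub>v v)"
        using col_mult2[OF H(2) W(2), of 0] by (simp only: col0 zero_less_Suc)
      also have "\<dots> = a \<cdot>\<^sub>v (e \<cdot>\<^sub>v v)"
        by (simp only: mult_mat_vec[OF H(2) v(1)] v(3))
      also have "\<dots> = e \<cdot>\<^sub>v col W 0"
        by (simp only: col0 smult_smult_assoc mult.commute)
      finally show ?thesis .
    qed
    have K0: "K $$ (i, 0) = (if i = 0 then e else 0)" if i: "i < Suc n" for i
    proof -
      have "K = mat_adjoint W * (H * W)"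
        using H(2) W(2) by (simp add: K_def assoc_mult_mat[of _ "Suc n" "Suc n" _ "Suc n" _ "Suc n"])
      then have "K $$ (i, 0) = row (mat_adjoint W) i \<bullet> col (H * W) 0"
        using i H(2) W(2) by simp
      also have "\<dots> = e * (row (mat_adjoint W) i \<bullet> col W 0)"
        using i W(2) unfolding colHW
        by (intro scalar_prod_smult_distrib[of _ "Suc n"] carrier_vecI) auto
      also have "row (mat_adjoint W) i \<bullet> col W 0 = (mat_adjoint W * W) $$ (i, 0)"
        using i W(2) by simp
      finally show ?thesis
        using i by (simp add: unitary_matD[OF W])
    qed
    have K0': "K $$ (0, j) = (if j = 0 then e else 0)" if j: "j < Suc n" for j
    proof -
      have "K $$ (0, j) = cnj (K $$ (j, 0))"
        using K j by (metis carrier_matD hermitian_def index_mat_adjoint zero_less_Suc)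
      moreover have "cnj e = e"
        using K K0[of 0] by (metis carrier_matD hermitian_def index_mat_adjoint zero_less_Suc)
      ultimately show ?thesis using K0[OF j] by simp
    qed
    define K1 where "K1 = mat n n (\<lambda>(i, j). K $$ (Suc i, Suc j))"
    have K1: "K1 \<in> carrier_mat n n" by (simp add: K1_def)
    have blockK: "K = four_block_mat (mat 1 1 (\<lambda>_. e)) (0\<^sub>m 1 n) (0\<^sub>m n 1) K1"
      by (rule eq_matI) (use K K0 K0' in \<open>auto simp: K1_def\<close>)
    have "hermitian K1"
      unfolding hermitian_def
    proof (rule eq_matI)
      fix i j assume "i < dim_row K1" "j < dim_col K1"
      then have ij: "i < n" "j < n" by (auto simp: K1_def)
      have "mat_adjoint K $$ (Suc i, Suc j) = cnj (K $$ (Suc j, Suc i))"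
        using ij K by (intro index_mat_adjoint) auto
      then have "K $$ (Suc i, Suc j) = cnj (K $$ (Suc j, Suc i))"
        using K(2) by (simp only: hermitian_def)
      then show "mat_adjoint K1 $$ (i, j) = K1 $$ (i, j)"
        using ij by (simp add: K1_def)
    qed (auto simp: K1_def)
    then obtain P where P: "unitary_mat P" "P \<in> carrier_mat n n"
      and diag: "diagonal_mat (mat_adjoint P * K1 * P)"
      using Suc.IH[OF _ K1] by blast
    let ?P = "block_one n P"
    note Pc = block_one_carrier[OF P(2)]
    have "mat_adjoint (W * ?P) * H * (W * ?P) = mat_adjoint ?P * K * ?P"
      unfolding mat_adjoint_mult[OF W(2) Pc] K_def
      by (rule assoc_mult_mat_5) (use W(2) Pc H(2) in auto)
    also have "\<dots> = four_block_mat (mat 1 1 (\<lambda>_. e)) (0\<^sub>m 1 n) (0\<^sub>m n 1) (mat_adjoint P * K1 * P)"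
      unfolding blockK by (rule conjugate_block) (use K1 P in auto)
    finally have "diagonal_mat (mat_adjoint (W * ?P) * H * (W * ?P))"
      using diag P(2) K1 by (auto simp: diagonal_mat_def)
    moreover have "unitary_mat (W * ?P)"
      by (rule unitary_mat_mult[OF W unitary_block_one[OF P] Pc])
    ultimately show ?case
      using W(2) Pc by (intro exI[of _ "W * ?P"]) auto
  qed
  then show ?thesis using that by blast
qed

section \<open>Singular values\<close>

lemma proots_prod_linear_factors: "proots (\<Prod>a\<leftarrow>as. [:- a, 1:]) = mset (as :: complex list)"
proof (induction as)
  case (Cons a as)
  have nz: "(\<Prod>a\<leftarrow>as. [:- a, 1:]) \<noteq> (0 :: complex poly)"
    by (auto simp: prod_list_zero_iff)
  have "proots ([:- a, 1:] * (\<Prod>a\<leftarrow>as. [:- a, 1:])) = proots [:- a, 1:] + proots (\<Prod>a\<leftarrow>as. [:- a, 1:])"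
    by (rule proots_mult[OF _ nz]) simp
  then show ?case
    unfolding list.map prod_list.Cons Cons.IH proots_linear_factor by simp
qed simp

lemma gram_mult:
  fixes N W :: "complex mat"
  assumes N: "N \<in> carrier_mat m n" and W: "W \<in> carrier_mat n k"
  shows "mat_adjoint (N * W) * (N * W) = mat_adjoint W * (mat_adjoint N * N) * W"
proof -
  have "mat_adjoint (N * W) * (N * W) = mat_adjoint W * (mat_adjoint N * (N * W))"
    unfolding mat_adjoint_mult[OF N W]
    by (rule assoc_mult_mat[of _ k n _ m _ k]) (use N W in auto)
  also have "mat_adjoint N * (N * W) = mat_adjoint N * N * W"
    by (rule assoc_mult_mat[symmetric, of _ n m _ n _ k]) (use N W in auto)
  also have "mat_adjoint W * (mat_adjoint N * N * W) = mat_adjoint W * (mat_adjoint N * N) * W"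
    by (rule assoc_mult_mat[symmetric, of _ k n _ n _ k]) (use N W in auto)
  finally show ?thesis .
qed

text \<open>
  Singular values are defined through the roots of a characteristic polynomial. If the unitary \<open>W\<close>
  diagonalizes \<open>N\<^sup>* N\<close>, these roots are the diagonal entries of \<open>(N W)\<^sup>* (N W)\<close>, which are the squared norms
  of the columns of \<open>N W\<close>. This links the number of nonzero singular values to the number of columns of
  \<open>N W\<close> that vanish.
\<close>

lemma singular_values_via_diagonalization:
  assumes N: "N \<in> carrier_mat m n" and W: "unitary_mat W" "W \<in> carrier_mat n n"
    and diag: "diagonal_mat (mat_adjoint W * (mat_adjoint N * N) * W)"
  shows "singular_values N = take (min m n) (rev (sort (map (\<lambda>c. sqrt (col_norm2 (N * W) c)) [0..<n])))"
proof -
  define H where "H = mat_adjoint N * N"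
  define E where "E = mat_adjoint W * H * W"
  have H: "H \<in> carrier_mat n n" using N by (auto simp: H_def)
  have E: "E \<in> carrier_mat n n" using H W by (auto simp: E_def)
  have EN: "E = mat_adjoint (N * W) * (N * W)"
    using gram_mult[OF N W(2)] by (simp add: E_def H_def)
  have "similar_mat E H"
    unfolding similar_mat_def using unitary_matD[OF W] H E W(2)
    by (intro exI[of _ "mat_adjoint W"] exI[of _ W] similar_mat_witI[of _ _ n])
      (simp_all add: E_def[symmetric])
  then have "char_poly H = char_poly E"
    by (rule char_poly_similar[symmetric])
  also have "upper_triangular E"
    using diag E unfolding E_def[symmetric] H_def[symmetric]
    by (auto simp: diagonal_mat_def upper_triangular_def)
  then have "char_poly E = (\<Prod>a\<leftarrow>diag_mat E. [:- a, 1:])"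
    by (rule char_poly_upper_triangular[OF E])
  finally have "proots (char_poly H) = mset (diag_mat E)"
    by (simp add: proots_prod_linear_factors)
  also have "diag_mat E = map (\<lambda>c. of_real (col_norm2 (N * W) c)) [0..<n]"
    using E col_norm2_gram[of "N * W" m n] N W unfolding EN by (auto simp: diag_mat_def)
  finally have "image_mset (\<lambda>z. sqrt (Re z)) (proots (char_poly H))
      = mset (map (\<lambda>c. sqrt (col_norm2 (N * W) c)) [0..<n])"
    by (simp only: mset_map image_mset.compositionality o_def Re_complex_of_real)
  then show ?thesis
    using N by (simp only: singular_values_def H_def sorted_list_of_multiset_mset carrier_matD)
qed

lemma gram_diagonalization:
  assumes N: "N \<in> carrier_mat m n"
  obtains W where "unitary_mat W" "W \<in> carrier_mat n n"
    "diagonal_mat (mat_adjoint W * (mat_adjoint N * N) * W)"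
proof -
  have "mat_adjoint N * N \<in> carrier_mat n n" using N by auto
  from hermitian_unitary_diagonalization[OF hermitian_gram[OF N] this] show ?thesis
    using that by blast
qed

lemma length_singular_values:
  assumes N: "N \<in> carrier_mat m n"
  shows "length (singular_values N) = min m n"
proof -
  obtain W where "unitary_mat W" "W \<in> carrier_mat n n"
    "diagonal_mat (mat_adjoint W * (mat_adjoint N * N) * W)"
    using gram_diagonalization[OF N] .
  from singular_values_via_diagonalization[OF N this] show ?thesis by simp
qed

definition sv_rank :: "complex mat \<Rightarrow> nat" where
  "sv_rank N = length (filter (\<lambda>x. x \<noteq> 0) (singular_values N))"

lemma length_filter_sort: "length (filter P (rev (sort xs))) = length (filter P xs)"
  for xs :: "real list"
proof -
  have "mset (filter P (rev (sort xs))) = mset (filter P xs)" by simp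
  then show ?thesis by (metis size_mset)
qed

lemma length_filter_map_upt:
  "length (filter P (map f [0..<n])) = card {c. c < n \<and> P (f c)}"
proof -
  have "length (filter P (map f [0..<n])) = length (filter (P \<circ> f) [0..<n])"
    by (simp add: filter_map)
  also have "\<dots> = card (set (filter (P \<circ> f) [0..<n]))"
    by (rule distinct_card[symmetric]) simp
  finally show ?thesis by (simp add: conj_commute)
qed

text \<open>
  Only an inequality: the first \<open>min m n\<close> entries of the sorted list are counted, while the columns of
  \<open>N * W\<close> number \<open>n\<close>.
\<close>

lemma sv_rank_le:
  assumes N: "N \<in> carrier_mat m n" and W: "unitary_mat W" "W \<in> carrier_mat n n"
    and diag: "diagonal_mat (mat_adjoint W * (mat_adjoint N * N) * W)"
  shows "sv_rank N \<le> card {c. c < n \<and> col_norm2 (N * W) c \<noteq> 0}"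
proof -
  let ?xs = "map (\<lambda>c. sqrt (col_norm2 (N * W) c)) [0..<n]"
  let ?ys = "rev (sort ?xs)"
  have "length (filter (\<lambda>x. x \<noteq> 0) (take (min m n) ?ys))
    \<le> length (filter (\<lambda>x. x \<noteq> 0) (take (min m n) ?ys @ drop (min m n) ?ys))"
    unfolding filter_append length_append by simp
  also have "\<dots> = card {c. c < n \<and> col_norm2 (N * W) c \<noteq> 0}"
    unfolding append_take_drop_id length_filter_sort length_filter_map_upt by simp
  finally show ?thesis
    by (simp add: sv_rank_def singular_values_via_diagonalization[OF assms])
qed

lemma decreasing_nonneg_zero_tail:
  fixes ys :: "real list"
  assumes "sorted (rev ys)" "\<And>y. y \<in> set ys \<Longrightarrow> 0 \<le> y"
    and "length (filter (\<lambda>x. x \<noteq> 0) (take k ys)) < k" "k \<le> length ys"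
  shows "filter (\<lambda>x. x \<noteq> 0) (drop k ys) = []"
proof -
  have "\<exists>i<k. ys ! i = 0"
  proof (rule ccontr)
    assume "\<not> (\<exists>i<k. ys ! i = 0)"
    then have "filter (\<lambda>x. x \<noteq> 0) (take k ys) = take k ys"
      using assms(4) by (intro filter_True) (auto simp: in_set_conv_nth)
    then show False using assms by simp
  qed
  then obtain i where i: "i < k" "ys ! i = 0" by blast
  have "y = 0" if y: "y \<in> set (drop k ys)" for y
  proof -
    obtain l where "y = drop k ys ! l" "l < length (drop k ys)"
      using y unfolding in_set_conv_nth by blast
    then have l: "y = ys ! (k + l)" "k + l < length ys" using assms(4) by auto
    then have "y \<le> ys ! i"
      using sorted_rev_nth_mono[OF assms(1), of i "k + l"] i by simp
    moreover have "0 \<le> y" using assms(2) l by simp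
    ultimately show ?thesis using i by simp
  qed
  then show ?thesis by (simp add: filter_empty_conv)
qed

text \<open>
  As soon as one of the \<open>min m n\<close> singular values vanishes, truncating the sorted list of the \<open>n\<close> roots
  drops nothing but zeros, and the count is exact.
\<close>

lemma sv_rank_eq:
  assumes N: "N \<in> carrier_mat m n" and W: "unitary_mat W" "W \<in> carrier_mat n n"
    and diag: "diagonal_mat (mat_adjoint W * (mat_adjoint N * N) * W)"
    and less: "sv_rank N < min m n"
  shows "sv_rank N = card {c. c < n \<and> col_norm2 (N * W) c \<noteq> 0}"
proof -
  let ?xs = "map (\<lambda>c. sqrt (col_norm2 (N * W) c)) [0..<n]"
  let ?ys = "rev (sort ?xs)"
  note sv = singular_values_via_diagonalization[OF N W diag]
  have "filter (\<lambda>x. x \<noteq> 0) (drop (min m n) ?ys) = []"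
    using less unfolding sv_rank_def sv
    by (intro decreasing_nonneg_zero_tail) (auto simp: col_norm2_nonneg)
  then have "sv_rank N = length (filter (\<lambda>x. x \<noteq> 0) (take (min m n) ?ys @ drop (min m n) ?ys))"
    unfolding filter_append length_append sv_rank_def sv by simp
  also have "\<dots> = card {c. c < n \<and> col_norm2 (N * W) c \<noteq> 0}"
    unfolding append_take_drop_id length_filter_sort length_filter_map_upt by simp
  finally show ?thesis .
qed

section \<open>Lower bounds for the approximation error of a matrix\<close>

text \<open>
  Slices of diagonal tubal matrices have this shape; the type differs from that of \<open>tdiag\<close>, whose
  entries are vectors.
\<close>

definition rect_diag :: "nat \<Rightarrow> nat \<Rightarrow> (nat \<Rightarrow> complex) \<Rightarrow> complex mat" where
  "rect_diag m n s = mat m n (\<lambda>(i, j). if i = j then s i else 0)"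

lemma rect_diag_carrier [simp]: "rect_diag m n s \<in> carrier_mat m n"
  by (simp add: rect_diag_def)

lemma rect_diag_cong:
  "(\<And>i. i < min m n \<Longrightarrow> s i = s' i) \<Longrightarrow> rect_diag m n s = rect_diag m n s'"
  by (rule eq_matI) (auto simp: rect_diag_def)

lemma index_rect_diag_mult:
  assumes Q: "Q \<in> carrier_mat n k" and "i < m" "c < k"
  shows "(rect_diag m n s * Q) $$ (i, c) = (if i < n then s i * Q $$ (i, c) else 0)"
proof -
  have "(rect_diag m n s * Q) $$ (i, c) = (\<Sum>j<n. rect_diag m n s $$ (i, j) * Q $$ (j, c))"
    using assms by (intro index_mult_sum[of _ m n _ k]) auto
  also have "\<dots> = (\<Sum>j<n. if j = i then s i * Q $$ (i, c) else 0)"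
    using assms by (intro sum.cong) (auto simp: rect_diag_def)
  finally show ?thesis by simp
qed

lemma col_norm2_rect_diag_mult:
  assumes Q: "Q \<in> carrier_mat n k" and c: "c < k"
  shows "col_norm2 (rect_diag m n s * Q) c
    = (\<Sum>i<min m n. (cmod (s i))\<^sup>2 * (cmod (Q $$ (i, c)))\<^sup>2)"
proof -
  have "col_norm2 (rect_diag m n s * Q) c
    = (\<Sum>i<m. if i < n then (cmod (s i))\<^sup>2 * (cmod (Q $$ (i, c)))\<^sup>2 else 0)"
    unfolding col_norm2_def using index_rect_diag_mult[OF Q _ c, of _ m s]
    by (intro sum.cong) (auto simp: rect_diag_def norm_mult power_mult_distrib)
  also have "\<dots> = (\<Sum>i\<in>{..<m} \<inter> {i. i < n}. (cmod (s i))\<^sup>2 * (cmod (Q $$ (i, c)))\<^sup>2)"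
    by (simp add: sum.inter_restrict)
  also have "{..<m} \<inter> {i. i < n} = {..<min m n}" by auto
  finally show ?thesis .
qed

lemma frob2_rect_diag:
  "frob2 (rect_diag m n s) = (\<Sum>i<min m n. (cmod (s i))\<^sup>2)"
proof -
  have "frob2 (rect_diag m n s) = (\<Sum>c<n. \<Sum>i<m. if i = c then (cmod (s c))\<^sup>2 else 0)"
    unfolding frob2_def col_norm2_def
    by (intro sum.cong) (auto simp: rect_diag_def)
  also have "\<dots> = (\<Sum>c<n. if c < m then (cmod (s c))\<^sup>2 else 0)"
    by (intro sum.cong) auto
  also have "\<dots> = (\<Sum>i\<in>{..<n} \<inter> {c. c < m}. (cmod (s i))\<^sup>2)"
    by (simp add: sum.inter_restrict)
  also have "{..<n} \<inter> {c. c < m} = {..<min m n}" by auto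
  finally show ?thesis .
qed

lemma frob2_diff_unitary_rect_diag:
  assumes U: "unitary_mat U" "U \<in> carrier_mat m m" and V: "unitary_mat V" "V \<in> carrier_mat n n"
  shows "frob2 (U * rect_diag m n s * mat_adjoint V - U * rect_diag m n s' * mat_adjoint V)
    = (\<Sum>i<min m n. (cmod (s i - s' i))\<^sup>2)"
proof -
  have D: "rect_diag m n s \<in> carrier_mat m n" "rect_diag m n s' \<in> carrier_mat m n"
    "rect_diag m n (\<lambda>i. s i - s' i) \<in> carrier_mat m n" by simp_all
  note UD = mult_carrier_mat[OF U(2) D(1)] mult_carrier_mat[OF U(2) D(2)] mult_carrier_mat[OF U(2) D(3)]
  have diff: "rect_diag m n s - rect_diag m n s' = rect_diag m n (\<lambda>i. s i - s' i)"
    by (rule eq_matI) (auto simp: rect_diag_def)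
  have "U * rect_diag m n s * mat_adjoint V - U * rect_diag m n s' * mat_adjoint V
      = U * rect_diag m n (\<lambda>i. s i - s' i) * mat_adjoint V"
    by (simp only: diff[symmetric] mult_minus_distrib_mat[OF U(2) D(1,2)]
        minus_mult_distrib_mat[OF UD(1,2) mat_adjoint_carrier[OF V(2)]])
  also have "frob2 \<dots> = frob2 (U * rect_diag m n (\<lambda>i. s i - s' i))"
    by (rule frob2_unitary_mult_right[OF unitary_mat_adjoint[OF V] mat_adjoint_carrier[OF V(2)] UD(3)])
  also have "\<dots> = (\<Sum>i<min m n. (cmod (s i - s' i))\<^sup>2)"
    by (simp only: frob2_unitary_mult_left[OF U D(3)] frob2_rect_diag)
  finally show ?thesis .
qed

text \<open>
  In the basis of a unitary \<open>W\<close> that diagonalizes \<open>N\<^sup>* N\<close>, the matrix \<open>N\<close> vanishes on the columns \<open>Z\<close> that span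
  its kernel, and there the error \<open>M - N\<close> agrees with \<open>M\<close>. Put \<open>Q = V\<^sup>* W\<close>. The columns in \<open>Z\<close> alone
  contribute \<open>\<Sum>\<^sub>i |s\<^sub>i|\<^sup>2 t\<^sub>i\<close> to the squared error, where \<open>t\<^sub>i = \<Sum>\<^sub>c\<^sub>\<in>\<^sub>Z |Q\<^sub>i\<^sub>c|\<^sup>2\<close>. Since the rows and columns of
  \<open>Q\<close> are unit vectors, each \<open>t\<^sub>i\<close> is at most 1 and all of them sum to the number of elements of \<open>Z\<close>. Stating the
  bound through weights, instead of through the tail of the sequence \<open>s\<close>, allows the slices to be
  added up before the threshold between kept and dropped values is chosen.
\<close>

lemma unitary_rect_diag_approximation_weights:
  assumes U: "unitary_mat U" "U \<in> carrier_mat m m" and V: "unitary_mat V" "V \<in> carrier_mat n n"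
    and M: "M = U * rect_diag m n s * mat_adjoint V" and N: "N \<in> carrier_mat m n"
  obtains t :: "nat \<Rightarrow> real" where
    "\<And>i. i < min m n \<Longrightarrow> 0 \<le> t i \<and> t i \<le> 1"
    "real (min m n) - real (sv_rank N) \<le> (\<Sum>i<min m n. t i)"
    "(\<Sum>i<min m n. (cmod (s i))\<^sup>2 * t i) \<le> frob2 (M - N)"
proof (cases "sv_rank N < min m n")
  case False
  \<comment> \<open>Zero weights do: no mass is required of them, and the error is nonnegative.\<close>
  then have "min m n \<le> sv_rank N" by (rule leI)
  then show ?thesis
    by (intro that[of "\<lambda>_. 0"]) (use frob2_nonneg[of "M - N"] in simp_all)
next
  case True
  obtain W where W: "unitary_mat W" "W \<in> carrier_mat n n"
    and diag: "diagonal_mat (mat_adjoint W * (mat_adjoint N * N) * W)"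
    using gram_diagonalization[OF N] .
  define D where "D = rect_diag m n s"
  define Q where "Q = mat_adjoint V * W"
  have D: "D \<in> carrier_mat m n" by (simp add: D_def)
  have M': "M \<in> carrier_mat m n" using M U V by auto
  have Q: "unitary_mat Q" "Q \<in> carrier_mat n n"
    using unitary_mat_mult[OF unitary_mat_adjoint[OF V] _ W] V W by (auto simp: Q_def)
  define Z where "Z = {c. c < n \<and> col_norm2 (N * W) c = 0}"
  define t where "t i = (\<Sum>c\<in>Z. (cmod (Q $$ (i, c)))\<^sup>2)" for i
  have finZ: "finite Z" and Zn: "Z \<subseteq> {..<n}" by (auto simp: Z_def)
  have row_sum: "(\<Sum>c<n. (cmod (Q $$ (i, c)))\<^sup>2) = 1" if "i < n" for i
    using col_norm2_unitary[OF unitary_mat_adjoint[OF Q] mat_adjoint_carrier[OF Q(2)] that] that Q(2)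
    by (simp add: col_norm2_def)
  have t01: "0 \<le> t i \<and> t i \<le> 1" if "i < n" for i
  proof -
    have "t i \<le> (\<Sum>c<n. (cmod (Q $$ (i, c)))\<^sup>2)"
      unfolding t_def using Zn by (intro sum_mono2) auto
    then show ?thesis using row_sum[OF that] by (auto simp: t_def sum_nonneg)
  qed
  have cardZ: "real (card Z) = real n - real (sv_rank N)"
  proof -
    have "{..<n} = Z \<union> {c. c < n \<and> col_norm2 (N * W) c \<noteq> 0}"
      by (auto simp: Z_def)
    moreover have "card (Z \<union> {c. c < n \<and> col_norm2 (N * W) c \<noteq> 0})
        = card Z + card {c. c < n \<and> col_norm2 (N * W) c \<noteq> 0}"
      by (rule card_Un_disjoint) (auto simp: Z_def)
    ultimately have "n = card Z + sv_rank N"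
      using sv_rank_eq[OF N W diag True] by (metis card_lessThan)
    then show ?thesis by linarith
  qed
  have sum_t: "(\<Sum>i<n. t i) = real (card Z)"
  proof -
    have "(\<Sum>i<n. t i) = (\<Sum>c\<in>Z. col_norm2 Q c)"
      unfolding t_def col_norm2_def using Q(2) by (subst sum.swap) simp
    also have "\<dots> = (\<Sum>c\<in>Z. 1)"
      using Zn by (intro sum.cong refl col_norm2_unitary[OF Q]) auto
    finally show ?thesis by simp
  qed
  have lower: "real (min m n) - real (sv_rank N) \<le> (\<Sum>i<min m n. t i)"
  proof -
    \<comment> \<open>The indices from \<open>min m n\<close> on carry no singular value; at most \<open>n - min m n\<close> of the mass is lost there.\<close>
    have "(\<Sum>i<n. t i) = (\<Sum>i<min m n. t i) + (\<Sum>i\<in>{min m n..<n}. t i)"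
      by (subst sum.union_disjoint[symmetric]) (auto intro: arg_cong[where f="sum t"])
    moreover have "(\<Sum>i\<in>{min m n..<n}. t i) \<le> (\<Sum>i\<in>{min m n..<n}. 1)"
      using t01 by (intro sum_mono) auto
    ultimately show ?thesis using sum_t cardZ by (simp add: of_nat_diff)
  qed
  have MW: "M * W = U * (D * Q)"
  proof -
    have "M * W = U * D * (mat_adjoint V * W)"
      unfolding M D_def[symmetric] by (rule assoc_mult_mat[of _ m n _ n _ n]) (use U V W D in auto)
    also have "\<dots> = U * (D * Q)"
      unfolding Q_def by (rule assoc_mult_mat[of _ m m _ n _ n]) (use U V W D in auto)
    finally show ?thesis .
  qed
  have DQ: "D * Q \<in> carrier_mat m n" using D Q by auto
  have "(\<Sum>i<min m n. (cmod (s i))\<^sup>2 * t i) = (\<Sum>c\<in>Z. col_norm2 (D * Q) c)"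
  proof -
    have "(\<Sum>c\<in>Z. col_norm2 (D * Q) c)
        = (\<Sum>c\<in>Z. \<Sum>i<min m n. (cmod (s i))\<^sup>2 * (cmod (Q $$ (i, c)))\<^sup>2)"
      unfolding D_def using Zn by (intro sum.cong refl col_norm2_rect_diag_mult[OF Q(2)]) auto
    then show ?thesis by (subst (asm) sum.swap) (simp add: t_def sum_distrib_left)
  qed
  also have "\<dots> = (\<Sum>c\<in>Z. col_norm2 ((M - N) * W) c)"
  proof (intro sum.cong refl)
    fix c assume c: "c \<in> Z"
    then have cn: "c < n" and zero: "col_norm2 (N * W) c = 0" by (auto simp: Z_def)
    have NW0: "(N * W) $$ (i, c) = 0" if "i < m" for i
      using zero that N unfolding col_norm2_def by (subst (asm) sum_nonneg_eq_0_iff) auto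
    have "col_norm2 ((M - N) * W) c = col_norm2 (M * W) c"
      using M' N W cn NW0 unfolding col_norm2_def minus_mult_distrib_mat[OF M' N W(2)]
      by (intro sum.cong) auto
    then show "col_norm2 (D * Q) c = col_norm2 ((M - N) * W) c"
      unfolding MW by (simp add: col_norm2_unitary_mult[OF U DQ cn])
  qed
  also have "\<dots> \<le> frob2 ((M - N) * W)"
    unfolding frob2_def using Zn W by (intro sum_mono2) (auto simp: col_norm2_nonneg)
  also have "\<dots> = frob2 (M - N)"
    by (rule frob2_unitary_mult_right[OF W]) (use M' N in auto)
  finally show ?thesis using that[of t] t01 lower by auto
qed

text \<open>
  Weights between 0 and 1 with at least the mass of the complement of \<open>K\<close> yield the least weighted
  sum when they sit on the smallest values. With \<open>e\<close> the indicator of the complement of \<open>K\<close>, every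
  product \<open>(f x - \<tau>) (w x - e x)\<close> is nonnegative: on \<open>K\<close> both factors are nonnegative, off \<open>K\<close> both are
  nonpositive. Summing them gives the claim.
\<close>

lemma rearrangement_threshold:
  fixes f w :: "'a \<Rightarrow> real"
  assumes fin: "finite X" and K: "K \<subseteq> X"
    and kept: "\<And>x. x \<in> K \<Longrightarrow> \<tau> \<le> f x" and dropped: "\<And>x. x \<in> X - K \<Longrightarrow> f x \<le> \<tau>"
    and \<tau>: "0 \<le> \<tau>" and w: "\<And>x. x \<in> X \<Longrightarrow> 0 \<le> w x \<and> w x \<le> 1"
    and mass: "real (card (X - K)) \<le> (\<Sum>x\<in>X. w x)"
  shows "(\<Sum>x\<in>X - K. f x) \<le> (\<Sum>x\<in>X. f x * w x)"
proof -
  let ?e = "\<lambda>x. if x \<in> K then 0 else 1 :: real"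
  have sum_e: "(\<Sum>x\<in>X. g x * ?e x) = (\<Sum>x\<in>X - K. g x)" for g :: "'a \<Rightarrow> real"
    by (rule sum.mono_neutral_cong_right) (use fin in auto)
  have "0 \<le> (\<Sum>x\<in>X. (f x - \<tau>) * (w x - ?e x))"
  proof (rule sum_nonneg)
    fix x assume x: "x \<in> X"
    show "0 \<le> (f x - \<tau>) * (w x - ?e x)"
      using kept[of x] dropped[of x] w[OF x] x
      by (cases "x \<in> K") (auto intro: mult_nonneg_nonneg mult_nonpos_nonpos)
  qed
  also have "\<dots> = (\<Sum>x\<in>X. f x * w x) - (\<Sum>x\<in>X. f x * ?e x)
      - \<tau> * ((\<Sum>x\<in>X. w x) - (\<Sum>x\<in>X. 1 * ?e x))"
    unfolding sum_distrib_left sum_subtractf[symmetric]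
    by (rule sum.cong) (simp_all add: algebra_simps)
  also have "\<dots> \<le> (\<Sum>x\<in>X. f x * w x) - (\<Sum>x\<in>X - K. f x)"
    using mult_nonneg_nonneg[OF \<tau>, of "(\<Sum>x\<in>X. w x) - real (card (X - K))"] mass
    unfolding sum_e by simp
  finally show ?thesis by simp
qed

text \<open>
  The matrix \<open>V\<close> diagonalizes the Gram matrix of the product, and the column norms that count are those
  of the diagonal factor.
\<close>

lemma sv_rank_unitary_rect_diag:
  assumes U: "unitary_mat U" "U \<in> carrier_mat m m" and V: "unitary_mat V" "V \<in> carrier_mat n n"
  shows "sv_rank (U * rect_diag m n s * mat_adjoint V) \<le> card {i. i < min m n \<and> s i \<noteq> 0}"
proof -
  define D where "D = rect_diag m n s"
  have D: "D \<in> carrier_mat m n" by (simp add: D_def)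
  define N where "N = U * D * mat_adjoint V"
  have N: "N \<in> carrier_mat m n" using U V D by (auto simp: N_def)
  have NV: "N * V = U * D"
  proof -
    have "N * V = U * D * (mat_adjoint V * V)"
      unfolding N_def by (rule assoc_mult_mat[of _ m n _ n _ n]) (use U V D in auto)
    also have "\<dots> = U * D"
      unfolding unitary_matD[OF V] using U D by (intro right_mult_one_mat) auto
    finally show ?thesis .
  qed
  have "mat_adjoint V * (mat_adjoint N * N) * V = mat_adjoint D * D"
    using gram_mult[OF N V(2)] gram_unitary_mult[OF U D] by (simp add: NV)
  moreover have "diagonal_mat (mat_adjoint D * D)"
    unfolding diagonal_mat_def
  proof (intro allI impI)
    fix i j assume ij: "i < dim_row (mat_adjoint D * D)" "j < dim_col (mat_adjoint D * D)" "i \<noteq> j"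
    then have "(mat_adjoint D * D) $$ (i, j) = (\<Sum>k<m. mat_adjoint D $$ (i, k) * D $$ (k, j))"
      using D by (intro index_mult_sum[of _ n m _ n]) auto
    also have "\<dots> = 0"
      using ij D by (intro sum.neutral) (auto simp: D_def rect_diag_def)
    finally show "(mat_adjoint D * D) $$ (i, j) = 0" .
  qed
  ultimately have "sv_rank N \<le> card {c. c < n \<and> col_norm2 (N * V) c \<noteq> 0}"
    using sv_rank_le[OF N V] by simp
  also have "\<dots> \<le> card {i. i < min m n \<and> s i \<noteq> 0}"
  proof (rule card_mono)
    show "{c. c < n \<and> col_norm2 (N * V) c \<noteq> 0} \<subseteq> {i. i < min m n \<and> s i \<noteq> 0}"
    proof safe
      fix c assume c: "c < n" "col_norm2 (N * V) c \<noteq> 0"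
      then have "col_norm2 D c \<noteq> 0"
        by (simp add: NV col_norm2_unitary_mult[OF U D])
      moreover have "col_norm2 D c = 0" if "\<forall>i<m. D $$ (i, c) = 0"
        using that D by (simp add: col_norm2_def)
      ultimately have "\<exists>i<m. D $$ (i, c) \<noteq> 0" by blast
      then obtain i where "i < m" "D $$ (i, c) \<noteq> 0" by blast
      then have "i = c" "c < m" "s c \<noteq> 0"
        using c by (auto simp: D_def rect_diag_def split: if_splits)
      then show "c < min m n" "s c = 0 \<Longrightarrow> False" using c by auto
    qed
  qed simp
  finally show ?thesis by (simp add: N_def D_def)
qed

section \<open>Tubal matrices and their slices\<close>

text \<open>
  The truncated diagonal factor may have entries that are not real, and so may the approximation
  built from it. The norm identities are therefore proved for arrays of complex vectors.
\<close>

definition tubal_arrays :: "nat \<Rightarrow> nat \<Rightarrow> nat \<Rightarrow> complex vec mat set" where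
  "tubal_arrays p m n = {A \<in> carrier_mat m n. \<forall>i<m. \<forall>j<n. A $$ (i, j) \<in> carrier_vec p}"

lemma tubal_arraysD:
  assumes "A \<in> tubal_arrays p m n"
  shows "A \<in> carrier_mat m n" "dim_row A = m" "dim_col A = n"
    "\<And>i j. i < m \<Longrightarrow> j < n \<Longrightarrow> A $$ (i, j) \<in> carrier_vec p"
  using assms by (auto simp: tubal_arrays_def)

lemma tubal_matrices_subset_arrays: "A \<in> tubal_matrices p m n \<Longrightarrow> A \<in> tubal_arrays p m n"
  by (auto simp: tubal_arrays_def tubal_matrices_def tubal_scalars_def)

lemma minus_tubal_arrays:
  "A \<in> tubal_arrays p m n \<Longrightarrow> B \<in> tubal_arrays p m n \<Longrightarrow> A - B \<in> tubal_arrays p m n"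
  by (auto simp: tubal_arrays_def intro!: minus_carrier_vec)

lemma slice_carrier:
  "A \<in> carrier_mat m n \<Longrightarrow> slice L A k \<in> carrier_mat m n"
  by (auto simp: slice_def)

lemma slice_tdiag:
  assumes "L \<in> carrier_mat p p" "k < p"
  shows "slice L (tdiag p m n s) k = rect_diag m n (\<lambda>i. phi L (s i) $ k)"
  by (rule eq_matI) (use assms in \<open>auto simp: slice_def tdiag_def rect_diag_def phi_def\<close>)

lemma tdiag_tubal_matrices:
  assumes "\<And>i. i < min m n \<Longrightarrow> s i \<in> tubal_scalars p"
  shows "tdiag p m n s \<in> tubal_matrices p m n"
  using assms by (auto simp: tubal_matrices_def tdiag_def tubal_scalars_def)

lemma tprod_tubal_matrices:
  assumes L: "real_preserving p L" and A: "A \<in> tubal_matrices p m l" and B: "B \<in> tubal_matrices p l n"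
  shows "tprod L A B \<in> tubal_matrices p m n"
proof -
  have "tmult L (A $$ (i, q)) (B $$ (q, j)) $ k \<in> \<real>" if "i < m" "q < l" "j < n" "k < p" for i q j k
  proof -
    have "tmult L (A $$ (i, q)) (B $$ (q, j)) \<in> tubal_scalars p"
      using L A B that by (simp add: real_preserving_def tubal_matrices_def)
    then show ?thesis using that by (simp add: tubal_scalars_def)
  qed
  then show ?thesis
    using L A B
    by (auto simp: tubal_matrices_def tprod_def tubal_scalars_def real_preserving_def intro!: sum_in_Reals)
qed

lemma ttranspose_tubal_matrices:
  assumes "doubly_real_preserving p L" "A \<in> tubal_matrices p m n"
  shows "ttranspose L A \<in> tubal_matrices p n m"
  using assms by (auto simp: doubly_real_preserving_def tubal_matrices_def ttranspose_def)

lemma B_rank_eq_sum_sv_rank: "B_rank L A = (\<Sum>k<dim_row L. sv_rank (slice L A k))"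
proof -
  have "length (filter P (concat (map f [0..<n]))) = (\<Sum>k<n. length (filter P (f k)))"
    for P :: "real \<Rightarrow> bool" and f n
    by (induction n) simp_all
  then show ?thesis
    unfolding B_rank_def B_singular_values_def sv_rank_def length_filter_sort by simp
qed

lemma length_B_singular_values:
  assumes "A \<in> carrier_mat m n"
  shows "length (B_singular_values L A) = dim_row L * min m n"
proof -
  have "length (concat (map f [0..<q])) = (\<Sum>k<q. length (f k))"
    for f :: "nat \<Rightarrow> real list" and q
    by (induction q) simp_all
  then show ?thesis
    using length_singular_values[OF slice_carrier[OF assms]]
    by (simp add: B_singular_values_def)
qed

text \<open>
  For a unitary \<open>L\<close> the inverse transform is multiplication by the adjoint. Applying \<open>L\<close> to every entry
  then turns the tubal operations into the matrix operations on each slice (products into products,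
  transposes into adjoints, orthogonal into unitary matrices), and it preserves the Frobenius norm.
\<close>

locale unitary_transform =
  fixes L :: "complex mat" and p :: nat
  assumes unitary: "unitary_mat L" and L_carrier: "L \<in> carrier_mat p p"
begin

lemma mat_inverse_eq_adjoint: "mat_inverse L = Some (mat_adjoint L)"
proof (cases "mat_inverse L")
  case None
  have "L \<in> Units (ring_mat TYPE(complex) p ())"
    unfolding Units_def using unitary_matD[OF unitary L_carrier] L_carrier
    by (auto simp: ring_mat_simps intro!: bexI[of _ "mat_adjoint L"])
  then show ?thesis
    using mat_inverse(1)[OF L_carrier None, of "()"] by blast
next
  case (Some B)
  have B: "L * B = 1\<^sub>m p" "B * L = 1\<^sub>m p" "B \<in> carrier_mat p p"
    using mat_inverse(2)[OF L_carrier Some] by auto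
  have "B = B * (L * mat_adjoint L)"
    using B by (simp add: unitary_matD[OF unitary L_carrier])
  also have "\<dots> = B * L * mat_adjoint L"
    by (rule assoc_mult_mat[symmetric, of _ p p _ p _ p]) (use B L_carrier in auto)
  also have "\<dots> = mat_adjoint L"
    unfolding B(2) by (intro left_mult_one_mat) (use L_carrier in auto)
  finally show ?thesis using Some by simp
qed

lemma dim_phi [simp]: "dim_vec (phi L a) = p"
  using L_carrier by (simp add: phi_def)

lemma phi_carrier [simp]: "phi L a \<in> carrier_vec p"
  by (rule carrier_vecI) simp

lemma phi_inv_carrier [simp]: "phi_inv L a \<in> carrier_vec p"
  using L_carrier by (intro carrier_vecI) (simp add: phi_inv_def mat_inverse_eq_adjoint)

lemma phi_phi_inv:
  assumes "a \<in> carrier_vec p"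
  shows "phi L (phi_inv L a) = a"
proof -
  have "phi L (phi_inv L a) = (L * mat_adjoint L) *\<^sub>v a"
    unfolding phi_def phi_inv_def mat_inverse_eq_adjoint option.sel
    by (rule assoc_mult_mat_vec[symmetric, of _ p p _ p]) (use L_carrier assms in auto)
  then show ?thesis
    using assms by (simp add: unitary_matD[OF unitary L_carrier])
qed

lemma phi_index:
  assumes "a \<in> carrier_vec p" "k < p"
  shows "phi L a $ k = (\<Sum>q<p. L $$ (k, q) * a $ q)"
  using assms L_carrier by (auto simp: phi_def scalar_prod_def atLeast0LessThan intro!: sum.cong)

lemma phi_norm:
  assumes a: "a \<in> carrier_vec p"
  shows "(\<Sum>k<p. (cmod (phi L a $ k))\<^sup>2) = (\<Sum>k<p. (cmod (a $ k))\<^sup>2)"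
proof -
  define X where "X = mat p 1 (\<lambda>(i, _). a $ i)"
  have X: "X \<in> carrier_mat p 1" by (simp add: X_def)
  have "phi L a $ k = (L * X) $$ (k, 0)" if "k < p" for k
    using that a by (subst index_mult_sum[OF L_carrier X]) (simp_all add: X_def phi_index)
  then have "(\<Sum>k<p. (cmod (phi L a $ k))\<^sup>2) = col_norm2 (L * X) 0"
    using L_carrier by (simp add: col_norm2_def)
  also have "\<dots> = col_norm2 X 0"
    by (rule col_norm2_unitary_mult[OF unitary L_carrier X]) simp
  finally show ?thesis by (simp add: col_norm2_def X_def)
qed

lemma tmult_carrier [simp]: "tmult L a b \<in> carrier_vec p"
  by (simp add: tmult_def)

lemma phi_tmult: "k < p \<Longrightarrow> phi L (tmult L a b) $ k = phi L a $ k * phi L b $ k"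
  unfolding tmult_def hadamard_def by (simp add: phi_phi_inv)

lemma phi_psi: "phi L (psi L a) = conjugate (phi L a)"
  unfolding psi_def by (rule phi_phi_inv) (simp add: carrier_vec_conjugate)

lemma tprod_tubal_arrays:
  assumes "A \<in> carrier_mat m l" "B \<in> carrier_mat l n"
  shows "tprod L A B \<in> tubal_arrays p m n"
  using assms L_carrier by (auto simp: tubal_arrays_def tprod_def)

lemma slice_tprod:
  assumes A: "A \<in> carrier_mat m l" and B: "B \<in> carrier_mat l n" and k: "k < p"
  shows "slice L (tprod L A B) k = slice L A k * slice L B k"
proof (rule eq_matI)
  fix i j assume "i < dim_row (slice L A k * slice L B k)" "j < dim_col (slice L A k * slice L B k)"
  then have ij: "i < m" "j < n" using A B by (auto simp: slice_def)
  let ?t = "\<lambda>q. tmult L (A $$ (i, q)) (B $$ (q, j))"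
  have "slice L (tprod L A B) k $$ (i, j) = phi L (vec p (\<lambda>k. \<Sum>q<l. ?t q $ k)) $ k"
    using ij A B L_carrier by (simp add: slice_def tprod_def)
  also have "\<dots> = (\<Sum>r<p. \<Sum>q<l. L $$ (k, r) * ?t q $ r)"
    using k by (simp add: phi_index sum_distrib_left)
  also have "\<dots> = (\<Sum>q<l. phi L (?t q) $ k)"
    using k by (subst sum.swap) (simp add: phi_index)
  also have "\<dots> = (\<Sum>q<l. slice L A k $$ (i, q) * slice L B k $$ (q, j))"
    using k ij A B by (intro sum.cong) (auto simp: phi_tmult slice_def)
  also have "\<dots> = (slice L A k * slice L B k) $$ (i, j)"
    by (rule index_mult_sum[symmetric]) (use ij slice_carrier[OF A] slice_carrier[OF B] in auto)
  finally show "slice L (tprod L A B) k $$ (i, j) = (slice L A k * slice L B k) $$ (i, j)" .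
qed (use A B in \<open>auto simp: slice_def tprod_def\<close>)

lemma slice_ttranspose:
  assumes k: "k < p"
  shows "slice L (ttranspose L A) k = mat_adjoint (slice L A k)"
proof (rule eq_matI)
  fix i j assume "i < dim_row (mat_adjoint (slice L A k))" "j < dim_col (mat_adjoint (slice L A k))"
  then have ij: "i < dim_col A" "j < dim_row A" by (auto simp: slice_def)
  then show "slice L (ttranspose L A) k $$ (i, j) = mat_adjoint (slice L A k) $$ (i, j)"
    using k by (simp add: slice_def ttranspose_def phi_psi)
qed (auto simp: slice_def ttranspose_def)

lemma slice_tidentity:
  assumes k: "k < p"
  shows "slice L (tidentity L n) k = 1\<^sub>m n"
proof -
  have "slice L (tidentity L n) k = rect_diag n n (\<lambda>_. 1)"
    using slice_tdiag[OF L_carrier k] L_carrier k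
    by (simp add: tidentity_def tunit_def phi_phi_inv)
  also have "\<dots> = 1\<^sub>m n"
    by (rule eq_matI) (auto simp: rect_diag_def)
  finally show ?thesis .
qed

lemma unitary_slice:
  assumes U: "torthogonal L n U" and k: "k < p"
  shows "unitary_mat (slice L U k)" "slice L U k \<in> carrier_mat n n"
proof -
  have Uc: "U \<in> carrier_mat n n"
    using U by (auto simp: torthogonal_def tubal_matrices_def)
  show c: "slice L U k \<in> carrier_mat n n" by (rule slice_carrier[OF Uc])
  have Ut: "ttranspose L U \<in> carrier_mat n n" using Uc by (auto simp: ttranspose_def)
  have "tprod L (ttranspose L U) U = tidentity L n" using U by (simp add: torthogonal_def)
  then have "mat_adjoint (slice L U k) * slice L U k = 1\<^sub>m n"
    using slice_tprod[OF Ut Uc k] k by (simp add: slice_tidentity slice_ttranspose)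
  then show "unitary_mat (slice L U k)" by (rule unitary_matI[OF c])
qed

lemma slice_minus:
  assumes A: "A \<in> tubal_arrays p m n" and B: "B \<in> tubal_arrays p m n" and k: "k < p"
  shows "slice L (A - B) k = slice L A k - slice L B k"
proof (rule eq_matI)
  fix i j assume "i < dim_row (slice L A k - slice L B k)" "j < dim_col (slice L A k - slice L B k)"
  then have ij: "i < m" "j < n" using tubal_arraysD[OF B] by (auto simp: slice_def)
  have "phi L (A $$ (i, j) - B $$ (i, j)) = phi L (A $$ (i, j)) - phi L (B $$ (i, j))"
    unfolding phi_def using L_carrier tubal_arraysD(4)[OF A ij] tubal_arraysD(4)[OF B ij]
    by (rule mult_minus_distrib_mat_vec)
  then show "slice L (A - B) k $$ (i, j) = (slice L A k - slice L B k) $$ (i, j)"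
    using ij k tubal_arraysD[OF A] tubal_arraysD[OF B]
    by (simp add: slice_def)
qed (use tubal_arraysD[OF A] tubal_arraysD[OF B] in \<open>auto simp: slice_def\<close>)

lemma frob_norm_eq_sum_slices:
  assumes A: "A \<in> tubal_arrays p m n"
  shows "(frob_norm A)\<^sup>2 = (\<Sum>k<p. frob2 (slice L A k))"
proof -
  note [simp] = tubal_arraysD(2,3)[OF A]
  have "(frob_norm A)\<^sup>2 = (\<Sum>i<m. \<Sum>j<n. \<Sum>k<p. (cmod (A $$ (i, j) $ k))\<^sup>2)"
    using carrier_vecD[OF tubal_arraysD(4)[OF A]] by (simp add: frob_norm_def sum_nonneg)
  also have "\<dots> = (\<Sum>i<m. \<Sum>j<n. \<Sum>k<p. (cmod (phi L (A $$ (i, j)) $ k))\<^sup>2)"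
    using tubal_arraysD(4)[OF A] by (simp add: phi_norm)
  also have "\<dots> = (\<Sum>i<m. \<Sum>k<p. \<Sum>j<n. (cmod (phi L (A $$ (i, j)) $ k))\<^sup>2)"
    by (rule sum.cong[OF refl], rule sum.swap)
  also have "\<dots> = (\<Sum>k<p. \<Sum>i<m. \<Sum>j<n. (cmod (phi L (A $$ (i, j)) $ k))\<^sup>2)"
    by (rule sum.swap)
  also have "\<dots> = (\<Sum>k<p. \<Sum>j<n. \<Sum>i<m. (cmod (phi L (A $$ (i, j)) $ k))\<^sup>2)"
    by (rule sum.cong[OF refl], rule sum.swap)
  also have "\<dots> = (\<Sum>k<p. frob2 (slice L A k))"
    by (simp add: frob2_def col_norm2_def slice_def)
  finally show ?thesis .
qed

end

section \<open>The best approximation\<close>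

context unitary_transform
begin

lemma slice_tsvd_product:
  assumes U: "torthogonal L m U" and V: "torthogonal L n V" and S: "S \<in> carrier_mat m n" and k: "k < p"
  shows "slice L (tprod L (tprod L U S) (ttranspose L V)) k
    = slice L U k * slice L S k * mat_adjoint (slice L V k)"
proof -
  have Uc: "U \<in> carrier_mat m m" and Vc: "V \<in> carrier_mat n n"
    using U V by (auto simp: torthogonal_def tubal_matrices_def)
  have Vt: "ttranspose L V \<in> carrier_mat n n"
    using Vc by (auto simp: ttranspose_def)
  have US: "tprod L U S \<in> carrier_mat m n"
    using tprod_tubal_arrays[OF Uc S] by (rule tubal_arraysD)
  show ?thesis
    by (simp add: slice_tprod[OF US Vt k] slice_tprod[OF Uc S k] slice_ttranspose[OF k])
qed

end

lemma sum_list_drop_eq_sum: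
  fixes g :: "real \<Rightarrow> real"
  shows "(\<Sum>x\<leftarrow>drop j xs. g x) = (\<Sum>l\<in>{j..<length xs}. g (xs ! l))"
proof -
  have "(\<Sum>x\<leftarrow>drop j xs. g x) = (\<Sum>i\<in>{0..<length xs - j}. g (xs ! (j + i)))"
    by (simp add: sum_list_sum_nth)
  also have "\<dots> = (\<Sum>l\<in>{j..<length xs}. g (xs ! l))"
    by (rule sum.reindex_bij_witness[of _ "\<lambda>l. l - j" "\<lambda>i. j + i"]) auto
  finally show ?thesis .
qed

theorem theorem3p6:
  fixes m n p j :: nat
    and L :: "complex mat"
    and A U S V Sj Aj :: "complex vec mat"
    and \<eta> :: "nat \<times> nat \<Rightarrow> nat"
    and d dj sj :: "nat \<Rightarrow> complex vec"
  assumes "0 < m" and "0 < n" and "0 < p"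
    and "doubly_real_preserving p L" and "unitary_mat L"
    and "A \<in> tubal_matrices p m n"
    and "is_tsvd L A U S V"
    and "s_diagonal L m n S"
    and "\<And>i. i < min m n \<Longrightarrow> d i = phi L (S $$ (i, i))"
    and "bij_betw \<eta> ({..<min m n} \<times> {..<p}) {..<p * min m n}"
    and "\<And>i k. i < min m n \<Longrightarrow> k < p \<Longrightarrow>
           d i $ k = of_real (B_singular_values L A ! \<eta> (i, k))"
    and "1 \<le> j" and "j < p * min m n"
    and "\<And>i. i < min m n \<Longrightarrow> dj i = vec p (\<lambda>k. if \<eta> (i, k) < j then d i $ k else 0)"
    and "\<And>i. i < min m n \<Longrightarrow> sj i = phi_inv L (dj i)"
    and "Sj = tdiag p m n sj"
    and "Aj = tprod L (tprod L U Sj) (ttranspose L V)"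
  shows "((\<forall>i < min m n. sj i \<in> tubal_scalars p) \<longrightarrow> Aj \<in> tubal_matrices p m n) \<and>
         B_rank L Aj \<le> j \<and>
         (\<forall>B \<in> tubal_matrices p m n. B_rank L B \<le> j \<longrightarrow> frob_norm (A - Aj) \<le> frob_norm (A - B)) \<and>
         (frob_norm (A - Aj))\<^sup>2 = (B_tail_energy L A j)\<^sup>2"
proof -
  note d = assms(9) and eta = assms(10) and d_eta = assms(11) and j = assms(13)
  have drp: "real_preserving p L" and L: "L \<in> carrier_mat p p"
    using assms(4) by (auto simp: doubly_real_preserving_def real_preserving_def)
  then have [simp]: "dim_row L = p" by simp
  interpret unitary_transform L p
    by unfold_locales (use assms(5) L in auto)
  define q where "q = min m n"
  \<comment> \<open>Index pairs \<open>(i, k)\<close> of the B-singular values; \<open>K\<close> holds the \<open>j\<close> pairs that the truncation keeps.\<close>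
  define X where "X = {..<q} \<times> {..<p}"
  define K where "K = {x \<in> X. \<eta> x < j}"
  define \<mu> where "\<mu> l = B_singular_values L A ! l" for l
  define f where "f x = (\<mu> (\<eta> x))\<^sup>2" for x
  have finX: "finite X" and KX: "K \<subseteq> X" by (auto simp: X_def K_def)
  have bij: "bij_betw \<eta> X {..<p * q}" using eta by (simp add: X_def q_def)
  have A: "A \<in> tubal_arrays p m n" using assms(6) by (rule tubal_matrices_subset_arrays)
  have Ac: "A \<in> carrier_mat m n" using A by (rule tubal_arraysD)
  have U: "torthogonal L m U" and V: "torthogonal L n V"
    and A_eq: "A = tprod L (tprod L U S) (ttranspose L V)"
    using assms(7) unfolding is_tsvd_def tubal_arraysD(2,3)[OF A] by blast+
  have S: "S \<in> carrier_mat m n"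
    using assms(8) by (auto simp: s_diagonal_def tubal_matrices_def)

  have len: "length (B_singular_values L A) = p * q"
    using length_B_singular_values[OF Ac] by (simp add: q_def)
  have mu_nonneg: "0 \<le> \<mu> l" if l: "l < p * q" for l
  proof -
    have "l \<in> \<eta> ` X" using bij_betw_imp_surj_on[OF bij] l by simp
    then obtain i k where ik: "i < q" "k < p" "l = \<eta> (i, k)"
      by (auto simp: X_def)
    have "complex_of_real (\<mu> l) = phi L (S $$ (i, i)) $ k"
      using d[of i] d_eta[of i k] ik by (simp add: q_def \<mu>_def)
    moreover have "0 \<le> Re (phi L (S $$ (i, i)) $ k)"
      using assms(8) ik by (auto simp: s_diagonal_def tscalar_psd_def q_def)
    ultimately show ?thesis by (metis Re_complex_of_real)
  qed
  have mu_mono: "\<mu> l' \<le> \<mu> l" if "l \<le> l'" "l' < p * q" for l l'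
    using sorted_rev_nth_mono[of "B_singular_values L A" l l'] that len
    by (simp add: \<mu>_def B_singular_values_def)

  have eta_less: "\<eta> x < p * q" if "x \<in> X" for x
    using bij_betw_apply[OF bij that] by simp
  have K_image: "\<eta> ` K = {..<j}"
  proof
    show "{..<j} \<subseteq> \<eta> ` K"
    proof
      fix l assume "l \<in> {..<j}"
      then have "l \<in> \<eta> ` X" "l < j"
        using bij_betw_imp_surj_on[OF bij] j by (simp_all add: q_def)
      then show "l \<in> \<eta> ` K" by (auto simp: K_def)
    qed
  qed (auto simp: K_def)
  have inj: "inj_on \<eta> X" using bij by (rule bij_betw_imp_inj_on)
  have cardK: "card K = j"
    using card_image[OF inj_on_subset[OF inj KX]] by (simp add: K_image)
  have XK_image: "\<eta> ` (X - K) = {j..<p * q}"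
    using inj_on_image_set_diff[OF inj _ KX, of X] bij_betw_imp_surj_on[OF bij] K_image by auto

  \<comment> \<open>Diagonals of the \<open>k\<close>-th slices of \<open>S\<close> and \<open>Sj\<close>.\<close>
  define \<sigma> where "\<sigma> k i = complex_of_real (\<mu> (\<eta> (i, k)))" for k i
  define \<sigma>j where "\<sigma>j k i = (if \<eta> (i, k) < j then \<sigma> k i else 0)" for k i
  have slice_S: "slice L S k = rect_diag m n (\<sigma> k)" if k: "k < p" for k
  proof (rule eq_matI)
    fix i i' assume "i < dim_row (rect_diag m n (\<sigma> k))" "i' < dim_col (rect_diag m n (\<sigma> k))"
    then have ii: "i < m" "i' < n" by (auto simp: rect_diag_def)
    show "slice L S k $$ (i, i') = rect_diag m n (\<sigma> k) $$ (i, i')"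
    proof (cases "i = i'")
      case True
      then show ?thesis
        using ii S d[of i] d_eta[of i k] k by (simp add: slice_def rect_diag_def \<sigma>_def \<mu>_def)
    next
      case False
      then have "S $$ (i, i') = 0\<^sub>v p"
        using assms(8) ii by (simp add: s_diagonal_def)
      then show ?thesis
        using False ii S k L by (simp add: slice_def rect_diag_def phi_def)
    qed
  qed (use S in \<open>auto simp: slice_def rect_diag_def\<close>)
  have slice_Sj: "slice L Sj k = rect_diag m n (\<sigma>j k)" if k: "k < p" for k
    unfolding assms(16) slice_tdiag[OF L k]
  proof (rule rect_diag_cong)
    fix i assume i: "i < min m n"
    have "phi L (sj i) = dj i"
      unfolding assms(15)[OF i] assms(14)[OF i] by (rule phi_phi_inv) simp
    then show "phi L (sj i) $ k = \<sigma>j k i"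
      using assms(14)[OF i] d_eta[OF i k] k by (simp add: \<sigma>j_def \<sigma>_def \<mu>_def)
  qed
  have Sj: "Sj \<in> carrier_mat m n" by (simp add: assms(16) tdiag_def)
  define Uk where "Uk k = slice L U k" for k
  define Vk where "Vk k = slice L V k" for k
  have Uk: "unitary_mat (Uk k)" "Uk k \<in> carrier_mat m m" if "k < p" for k
    using unitary_slice[OF U that] by (simp_all add: Uk_def)
  have Vk: "unitary_mat (Vk k)" "Vk k \<in> carrier_mat n n" if "k < p" for k
    using unitary_slice[OF V that] by (simp_all add: Vk_def)
  have slice_A: "slice L A k = Uk k * rect_diag m n (\<sigma> k) * mat_adjoint (Vk k)" if "k < p" for k
    using slice_tsvd_product[OF U V S that] slice_S[OF that] by (simp add: A_eq[symmetric] Uk_def Vk_def)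
  have slice_Aj: "slice L Aj k = Uk k * rect_diag m n (\<sigma>j k) * mat_adjoint (Vk k)" if "k < p" for k
    using slice_tsvd_product[OF U V Sj that] slice_Sj[OF that] by (simp add: assms(17) Uk_def Vk_def)

  have sum_X: "(\<Sum>k<p. \<Sum>i<q. g i k) = (\<Sum>x\<in>X. g (fst x) (snd x))" for g :: "nat \<Rightarrow> nat \<Rightarrow> real"
    unfolding X_def by (subst sum.swap) (simp add: sum.cartesian_product case_prod_beta)

  have real: "Aj \<in> tubal_matrices p m n" if "\<forall>i < min m n. sj i \<in> tubal_scalars p"
  proof -
    have "U \<in> tubal_matrices p m m" "ttranspose L V \<in> tubal_matrices p n n"
      using U V ttranspose_tubal_matrices[OF assms(4)] by (auto simp: torthogonal_def)
    moreover have "Sj \<in> tubal_matrices p m n"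
      unfolding assms(16) using that by (intro tdiag_tubal_matrices) auto
    ultimately show ?thesis
      unfolding assms(17) by (intro tprod_tubal_matrices[OF drp])
  qed

  have rank: "B_rank L Aj \<le> j"
  proof -
    have "real (sv_rank (slice L Aj k)) \<le> (\<Sum>i<q. if \<eta> (i, k) < j then 1 else 0)" if k: "k < p" for k
    proof -
      have "sv_rank (slice L Aj k) \<le> card {i. i < q \<and> \<sigma>j k i \<noteq> 0}"
        unfolding slice_Aj[OF k] q_def by (rule sv_rank_unitary_rect_diag[OF Uk[OF k] Vk[OF k]])
      also have "\<dots> \<le> card {i \<in> {..<q}. \<eta> (i, k) < j}"
        by (rule card_mono) (auto simp: \<sigma>j_def split: if_splits)
      finally show ?thesis by (simp add: sum.If_cases Int_def)
    qed
    then have "(\<Sum>k<p. real (sv_rank (slice L Aj k))) \<le> (\<Sum>k<p. \<Sum>i<q. if \<eta> (i, k) < j then 1 else 0)"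
      by (intro sum_mono) simp
    also have "\<dots> = real (card K)"
      unfolding sum_X using finX by (simp add: sum.If_cases K_def Int_def)
    finally show ?thesis by (simp add: B_rank_eq_sum_sv_rank cardK flip: of_nat_sum)
  qed

  have error: "(frob_norm (A - Aj))\<^sup>2 = (\<Sum>x\<in>X - K. f x)"
  proof -
    have Aj: "Aj \<in> tubal_arrays p m n"
    proof -
      have "tprod L U Sj \<in> carrier_mat m n"
        using tprod_tubal_arrays[of U m m Sj n] U Sj
        by (auto simp: torthogonal_def tubal_matrices_def tubal_arrays_def)
      moreover have "ttranspose L V \<in> carrier_mat n n"
        using V by (auto simp: torthogonal_def tubal_matrices_def ttranspose_def)
      ultimately show ?thesis unfolding assms(17) by (rule tprod_tubal_arrays)
    qed
    have "(frob_norm (A - Aj))\<^sup>2 = (\<Sum>k<p. frob2 (slice L A k - slice L Aj k))"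
      by (simp add: frob_norm_eq_sum_slices[OF minus_tubal_arrays[OF A Aj]] slice_minus[OF A Aj])
    also have "\<dots> = (\<Sum>k<p. \<Sum>i<q. (cmod (\<sigma> k i - \<sigma>j k i))\<^sup>2)"
      using frob2_diff_unitary_rect_diag[OF Uk Vk] by (simp add: slice_A slice_Aj q_def)
    also have "\<dots> = (\<Sum>x\<in>X. if x \<in> K then 0 else f x)"
      unfolding sum_X by (intro sum.cong) (auto simp: K_def \<sigma>j_def \<sigma>_def f_def)
    also have "\<dots> = (\<Sum>x\<in>X - K. f x)"
      by (rule sum.mono_neutral_cong_right) (use finX in auto)
    finally show ?thesis .
  qed

  have tail: "(B_tail_energy L A j)\<^sup>2 = (\<Sum>x\<in>X - K. f x)"
  proof -
    have "(B_tail_energy L A j)\<^sup>2 = (\<Sum>l\<in>{j..<p * q}. (\<mu> l)\<^sup>2)"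
      unfolding B_tail_energy_def sum_list_drop_eq_sum len \<mu>_def by (simp add: sum_nonneg)
    also have "\<dots> = (\<Sum>x\<in>X - K. f x)"
      unfolding XK_image[symmetric] f_def
      using inj_on_subset[OF inj, of "X - K"] by (simp add: sum.reindex)
    finally show ?thesis .
  qed

  have optimal: "frob_norm (A - Aj) \<le> frob_norm (A - B)"
    if B: "B \<in> tubal_matrices p m n" and rankB: "B_rank L B \<le> j" for B
  proof -
    have Ba: "B \<in> tubal_arrays p m n" using B by (rule tubal_matrices_subset_arrays)
    have Bk: "slice L B k \<in> carrier_mat m n" for k
      using slice_carrier tubal_arraysD(1)[OF Ba] .
    define good where "good k t \<longleftrightarrow> (\<forall>i<q. 0 \<le> t i \<and> t i \<le> (1 :: real)) \<and>
        real q - real (sv_rank (slice L B k)) \<le> (\<Sum>i<q. t i) \<and>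
        (\<Sum>i<q. (cmod (\<sigma> k i))\<^sup>2 * t i) \<le> frob2 (slice L A k - slice L B k)" for k t
    have "\<exists>t. k < p \<longrightarrow> good k t" for k
    proof (cases "k < p")
      case k: True
      show ?thesis
        by (rule unitary_rect_diag_approximation_weights[OF Uk[OF k] Vk[OF k] slice_A[OF k] Bk])
          (auto simp: good_def q_def)
    qed simp
    then obtain T where "\<And>k. k < p \<longrightarrow> good k (T k)"
      using choice[of "\<lambda>k t. k < p \<longrightarrow> good k t"] by blast
    then have T: "\<And>k i. k < p \<Longrightarrow> i < q \<Longrightarrow> 0 \<le> T k i \<and> T k i \<le> 1"
      and T_mass: "\<And>k. k < p \<Longrightarrow> real q - real (sv_rank (slice L B k)) \<le> (\<Sum>i<q. T k i)"
      and T_frob: "\<And>k. k < p \<Longrightarrow>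
        (\<Sum>i<q. (cmod (\<sigma> k i))\<^sup>2 * T k i) \<le> frob2 (slice L A k - slice L B k)"
      by (simp_all add: good_def)
    \<comment> \<open>The ranks of the slices of \<open>B\<close> add up to its B-rank, so the total mass of all weights is at least
        \<open>p * q - j\<close>, the number of dropped pairs.\<close>
    have mass: "real (card (X - K)) \<le> (\<Sum>x\<in>X. T (snd x) (fst x))"
    proof -
      have "real (card (X - K)) = real (p * q) - real j"
        using card_Diff_subset[OF finite_subset[OF KX finX] KX] cardK j
        by (simp add: X_def q_def of_nat_diff mult.commute)
      also have "\<dots> \<le> real (p * q) - real (B_rank L B)" using rankB by simp
      also have "\<dots> = (\<Sum>k<p. real q - real (sv_rank (slice L B k)))"
        by (simp add: B_rank_eq_sum_sv_rank sum_subtractf)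
      also have "\<dots> \<le> (\<Sum>k<p. \<Sum>i<q. T k i)"
        using T_mass by (intro sum_mono) auto
      also have "\<dots> = (\<Sum>x\<in>X. T (snd x) (fst x))" by (rule sum_X)
      finally show ?thesis .
    qed
    have "(frob_norm (A - Aj))\<^sup>2 = (\<Sum>x\<in>X - K. f x)" by (rule error)
    also have "\<dots> \<le> (\<Sum>x\<in>X. f x * T (snd x) (fst x))"
    \<comment> \<open>The first dropped B-singular value \<open>\<mu> j\<close> separates the kept values from the dropped ones.\<close>
    proof (rule rearrangement_threshold[OF finX KX _ _ _ _ mass])
      fix x assume x: "x \<in> K"
      then have "\<mu> j \<le> \<mu> (\<eta> x)" using mu_mono[of "\<eta> x" j] j by (simp add: K_def q_def)
      then show "(\<mu> j)\<^sup>2 \<le> f x"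
        unfolding f_def using mu_nonneg[of j] j by (intro power_mono) (simp_all add: q_def)
    next
      fix x assume x: "x \<in> X - K"
      then have "j \<le> \<eta> x" "\<eta> x < p * q" using eta_less by (auto simp: K_def)
      then show "f x \<le> (\<mu> j)\<^sup>2"
        unfolding f_def using mu_nonneg mu_mono by (intro power_mono) auto
    qed (use T in \<open>auto simp: X_def\<close>)
    also have "\<dots> = (\<Sum>k<p. \<Sum>i<q. (cmod (\<sigma> k i))\<^sup>2 * T k i)"
      unfolding sum_X by (simp add: f_def \<sigma>_def)
    also have "\<dots> \<le> (\<Sum>k<p. frob2 (slice L A k - slice L B k))"
      using T_frob by (intro sum_mono) auto
    also have "\<dots> = (frob_norm (A - B))\<^sup>2"
      by (simp add: frob_norm_eq_sum_slices[OF minus_tubal_arrays[OF A Ba]] slice_minus[OF A Ba])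
    finally show ?thesis
      by (rule power2_le_imp_le) (simp add: frob_norm_def sum_nonneg)
  qed

  show ?thesis using real rank optimal error tail by simp
qed

end
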